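(* For every integer $m\ge 0$, $$S_{m+1}=7\,(O_m+S_m),$$ where $O_m$ and $S_m$ are respectively the numbers of copies of the octonions and of quasi-octonion algebras $\mathbb P_k$ ($k\in\{4,12,14\}$, counted in total) in $\mathbb U_m$, with $\mathbb U_0=\mathbb O$.
   Context: The real algebras $\mathbb A_n$ are defined recursively: $\mathbb A_0=\mathbb R$ with trivial conjugation, and $\mathbb A_n=\mathbb A_{n-1}\oplus\mathbb A_{n-1}$ with $(x,y)(z,w)=(xz-w^*y,\; wx+yz^* )$ and $(x,y)^*=(x^*,-y)$. The graded basis of $\mathbb A_n$ is $\{\mathrm o_\alpha:\alpha\subseteq\{1,\dots,n\}\}$, with $\mathrm o_\emptyset=1$ and, for $\alpha\subseteq\{1,\dots,n-1\}$, $\mathrm o_\alpha=(\mathrm o_\alpha,0)$ and $\mathrm o_{\alpha\cup\{n\}}=(0,\mathrm o_\alpha)$; indices are written as strings, e.g. $\mathrm o_{34}=\mathrm o_{\{3,4\}}$. Write $\mathbb U_m=\mathbb A_{m+3}$; $\mathbb U_0=\mathbb O$ is the octonions and $\mathbb U_1$ the sedenions. Quasi-octonion algebras: $\mathbb P_4$ is (up to isomorphism) the subalgebra of $\mathbb U_1$ generated by $\mathrm o_1,\mathrm o_2,\mathrm o_{34}$; $\mathbb P_{12}$ is the subalgebra of $\mathbb U_2$ generated by $\mathrm o_1,\mathrm o_{24},\mathrm o_{345}$; $\mathbb P_{14}$ is the subalgebra of $\mathbb U_3$ generated by $\mathrm o_{14},\mathrm o_{25},\mathrm o_{36}$. Each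 is 8-dimensional. A copy of $\mathbb O$ (respectively of $\mathbb P_k$) in $\mathbb U_m$ is an 8-dimensional subalgebra of $\mathbb U_m$ spanned by $1$ and seven pure basis elements $\mathrm o_\alpha$ ($\alpha\ne\emptyset$) that is isomorphic or anti-isomorphic to $\mathbb O$ (respectively $\mathbb P_k$). $O_m$ is the number of copies of $\mathbb O$ in $\mathbb U_m$, and $S_m$ is the total number of copies of $\mathbb P_4$, $\mathbb P_{12}$ and $\mathbb P_{14}$ in $\mathbb U_m$. *)

theory Defs
  imports Complex_Main "HOL-Library.Function_Algebras"
begin

instantiation "fun" :: (type, real_vector) real_vector
begin

definition scaleR_fun :: "real \<Rightarrow> ('a \<Rightarrow> 'b) \<Rightarrow> 'a \<Rightarrow> 'b"
  where "scaleR_fun c f = (\<lambda>x. c *\<^sub>R f x)"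

instance
  by standard (auto simp: scaleR_fun_def fun_eq_iff scaleR_add_right scaleR_add_left)

end

text \<open>
  An element of the algebra \<open>A\<^sub>n\<close> is given by its coordinates in the graded basis, so
  it is a function on sets of natural numbers vanishing off the subsets of \<open>{1..n}\<close>. An
  element \<open>x\<close> of \<open>A\<^sub>n\<close> and the element \<open>(x, 0)\<close> of \<open>A\<^sub>n\<^sub>+\<^sub>1\<close> are the same function.
  The algebra product is \<open>cd_mult n\<close>; the pointwise product and the constant function
  \<open>1\<close> that functions get from the library are not used. The unit is \<open>cd_basis {}\<close>.
\<close>

definition cd_space :: "nat \<Rightarrow> (nat set \<Rightarrow> real) set"
  where "cd_space n = {x. \<forall>\<alpha>. x \<alpha> \<noteq> 0 \<longrightarrow> \<alpha> \<subseteq> {1..n}}"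

definition cd_basis :: "nat set \<Rightarrow> (nat set \<Rightarrow> real)"
  where "cd_basis \<alpha> = (\<lambda>\<beta>. if \<beta> = \<alpha> then 1 else 0)"

text \<open>
  \<open>cd_pair n\<close> identifies pairs of elements of \<open>A\<^sub>n\<close> with elements of \<open>A\<^sub>n\<^sub>+\<^sub>1\<close>, and
  \<open>cd_fst n\<close>, \<open>cd_snd n\<close> are its two projections.
\<close>

definition cd_pair :: "nat \<Rightarrow> (nat set \<Rightarrow> real) \<Rightarrow> (nat set \<Rightarrow> real) \<Rightarrow> (nat set \<Rightarrow> real)"
  where "cd_pair n x y = (\<lambda>\<alpha>. if Suc n \<in> \<alpha> then y (\<alpha> - {Suc n}) else x \<alpha>)"

definition cd_fst :: "nat \<Rightarrow> (nat set \<Rightarrow> real) \<Rightarrow> (nat set \<Rightarrow> real)"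
  where "cd_fst n x = (\<lambda>\<alpha>. if Suc n \<in> \<alpha> then 0 else x \<alpha>)"

definition cd_snd :: "nat \<Rightarrow> (nat set \<Rightarrow> real) \<Rightarrow> (nat set \<Rightarrow> real)"
  where "cd_snd n x = (\<lambda>\<alpha>. if Suc n \<in> \<alpha> then 0 else x (insert (Suc n) \<alpha>))"

primrec cd_conj :: "nat \<Rightarrow> (nat set \<Rightarrow> real) \<Rightarrow> (nat set \<Rightarrow> real)" where
  "cd_conj 0 x = x"
| "cd_conj (Suc n) x = cd_pair n (cd_conj n (cd_fst n x)) (- cd_snd n x)"

primrec cd_mult :: "nat \<Rightarrow> (nat set \<Rightarrow> real) \<Rightarrow> (nat set \<Rightarrow> real) \<Rightarrow> (nat set \<Rightarrow> real)" where
  "cd_mult 0 u v = (u {} * v {}) *\<^sub>R cd_basis {}"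
| "cd_mult (Suc n) u v =
    (let x = cd_fst n u; y = cd_snd n u; z = cd_fst n v; w = cd_snd n v in
      cd_pair n (cd_mult n x z - cd_mult n (cd_conj n w) y)
                (cd_mult n w x + cd_mult n y (cd_conj n z)))"

text \<open>The encoding satisfies the defining recursions of the Cayley--Dickson algebras.\<close>

lemma cd_space_iff: "x \<in> cd_space n \<longleftrightarrow> (\<forall>\<alpha>. \<not> \<alpha> \<subseteq> {1..n} \<longrightarrow> x \<alpha> = 0)"
  by (auto simp: cd_space_def)

lemma cd_space_Suc_mem: "x \<in> cd_space n \<Longrightarrow> Suc n \<in> \<alpha> \<Longrightarrow> x \<alpha> = 0"
  unfolding cd_space_iff by (metis Suc_n_not_le_n atLeastAtMost_iff subsetD)

lemma cd_fst_pair: "x \<in> cd_space n \<Longrightarrow> cd_fst n (cd_pair n x y) = x"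
  by (rule ext) (simp add: cd_fst_def cd_pair_def cd_space_Suc_mem)

lemma cd_snd_pair: "y \<in> cd_space n \<Longrightarrow> cd_snd n (cd_pair n x y) = y"
  by (rule ext) (simp add: cd_snd_def cd_pair_def cd_space_Suc_mem)

lemma cd_space_0: "cd_space 0 = {c *\<^sub>R cd_basis {} | c. True}"
proof (intro equalityI subsetI)
  fix x
  assume "x \<in> cd_space 0"
  then have "x \<alpha> = (x {} *\<^sub>R cd_basis {}) \<alpha>" for \<alpha>
    by (cases "\<alpha> = {}") (simp_all add: cd_space_iff cd_basis_def scaleR_fun_def)
  then have "x = x {} *\<^sub>R cd_basis {}" by (rule ext)
  then show "x \<in> {c *\<^sub>R cd_basis {} | c. True}" by blast
next
  fix x
  assume "x \<in> {c *\<^sub>R cd_basis {} | c. True}"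
  then obtain c where x: "x = c *\<^sub>R cd_basis {}" by blast
  show "x \<in> cd_space 0" by (simp add: x cd_space_iff cd_basis_def scaleR_fun_def)
qed

lemma subset_Icc_Suc: "\<alpha> \<subseteq> {1..Suc n} \<longleftrightarrow> \<alpha> - {Suc n} \<subseteq> {1..n}"
proof -
  have "{1..Suc n} = insert (Suc n) {1..n}" by auto
  then show ?thesis by (simp only: subset_insert_iff split: if_split) auto
qed

lemma cd_space_Suc:
  "cd_space (Suc n) = {cd_pair n x y | x y. x \<in> cd_space n \<and> y \<in> cd_space n}"
proof (intro equalityI subsetI)
  fix u
  assume u: "u \<in> cd_space (Suc n)"
  have "u = cd_pair n (cd_fst n u) (cd_snd n u)"
    by (rule ext) (simp add: cd_pair_def cd_fst_def cd_snd_def insert_absorb)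
  moreover have "cd_fst n u \<in> cd_space n"
    unfolding cd_space_iff
  proof (intro allI impI)
    fix \<alpha> assume "\<not> \<alpha> \<subseteq> {1..n}"
    then have sub: "\<not> \<alpha> \<subseteq> {1..Suc n}" if "Suc n \<notin> \<alpha>"
      using that by (simp only: subset_Icc_Suc Diff_insert0 Diff_empty simp_thms)
    show "cd_fst n u \<alpha> = 0"
    proof (cases "Suc n \<in> \<alpha>")
      case True
      then show ?thesis by (simp add: cd_fst_def)
    next
      case False
      then have "u \<alpha> = 0" using u sub unfolding cd_space_iff by blast
      then show ?thesis by (simp add: cd_fst_def)
    qed
  qed
  moreover have "cd_snd n u \<in> cd_space n"
    unfolding cd_space_iff
  proof (intro allI impI)
    fix \<alpha> assume "\<not> \<alpha> \<subseteq> {1..n}"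
    then have ins: "\<not> insert (Suc n) \<alpha> \<subseteq> {1..Suc n}" if "Suc n \<notin> \<alpha>"
      using that by (simp only: subset_Icc_Suc insert_Diff1 Diff_insert0 Diff_empty singletonI simp_thms)
    show "cd_snd n u \<alpha> = 0"
    proof (cases "Suc n \<in> \<alpha>")
      case True
      then show ?thesis by (simp add: cd_snd_def)
    next
      case False
      then have "u (insert (Suc n) \<alpha>) = 0" using u ins unfolding cd_space_iff by blast
      then show ?thesis by (simp add: cd_snd_def)
    qed
  qed
  ultimately show "u \<in> {cd_pair n x y | x y. x \<in> cd_space n \<and> y \<in> cd_space n}"
    by blast
next
  fix u
  assume "u \<in> {cd_pair n x y | x y. x \<in> cd_space n \<and> y \<in> cd_space n}"
  then obtain x y where u: "u = cd_pair n x y" and x: "x \<in> cd_space n" and y: "y \<in> cd_space n"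
    by blast
  show "u \<in> cd_space (Suc n)"
    unfolding cd_space_iff
  proof (intro allI impI)
    fix \<alpha> assume \<alpha>: "\<not> \<alpha> \<subseteq> {1..Suc n}"
    show "u \<alpha> = 0"
    proof (cases "Suc n \<in> \<alpha>")
      case True
      have "\<not> \<alpha> - {Suc n} \<subseteq> {1..n}"
        using \<alpha> by (simp only: subset_Icc_Suc simp_thms)
      then show ?thesis using True y by (simp add: u cd_pair_def cd_space_iff)
    next
      case False
      have "\<not> \<alpha> \<subseteq> {1..n}"
        using \<alpha> False by (simp only: subset_Icc_Suc Diff_insert0 Diff_empty simp_thms)
      then show ?thesis using False x by (simp add: u cd_pair_def cd_space_iff)
    qed
  qed
qed

lemma cd_conj_pair:
  assumes "x \<in> cd_space n" "y \<in> cd_space n"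
  shows "cd_conj (Suc n) (cd_pair n x y) = cd_pair n (cd_conj n x) (- y)"
  using assms by (simp add: cd_fst_pair cd_snd_pair)

lemma cd_mult_pair:
  assumes "x \<in> cd_space n" "y \<in> cd_space n" "z \<in> cd_space n" "w \<in> cd_space n"
  shows "cd_mult (Suc n) (cd_pair n x y) (cd_pair n z w) =
    cd_pair n (cd_mult n x z - cd_mult n (cd_conj n w) y)
              (cd_mult n w x + cd_mult n y (cd_conj n z))"
  using assms by (simp add: cd_fst_pair cd_snd_pair)

lemma cd_basis_fst:
  assumes "\<alpha> \<subseteq> {1..n}"
  shows "cd_basis \<alpha> = cd_pair n (cd_basis \<alpha>) 0"
proof -
  have "Suc n \<notin> \<alpha>" using assms by auto
  then have "\<beta> \<noteq> \<alpha>" if "Suc n \<in> \<beta>" for \<beta>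
    using that by blast
  then show ?thesis by (simp add: cd_basis_def cd_pair_def fun_eq_iff)
qed

lemma cd_basis_snd:
  assumes "\<alpha> \<subseteq> {1..n}"
  shows "cd_basis (insert (Suc n) \<alpha>) = cd_pair n 0 (cd_basis \<alpha>)"
proof -
  have "Suc n \<notin> \<alpha>" using assms by auto
  then have "(\<beta> = insert (Suc n) \<alpha>) = (Suc n \<in> \<beta> \<and> \<beta> - {Suc n} = \<alpha>)" for \<beta>
    by blast
  then show ?thesis by (simp add: cd_basis_def cd_pair_def fun_eq_iff)
qed

definition cd_subalgebra :: "nat \<Rightarrow> (nat set \<Rightarrow> real) set \<Rightarrow> bool"
  where "cd_subalgebra n A \<longleftrightarrow> subspace A \<and> A \<subseteq> cd_space n \<and> cd_basis {} \<in> A \<and>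
    (\<forall>x\<in>A. \<forall>y\<in>A. cd_mult n x y \<in> A)"

text \<open>
  In the next two definitions \<open>A\<close> is a subalgebra of \<open>A\<^sub>n\<close> and \<open>B\<close> one of \<open>A\<^sub>k\<close>. Every
  linear map from a subspace extends to the whole type, so it is no restriction to ask
  for a map that is linear everywhere.
\<close>

definition cd_isomorphic ::
  "nat \<Rightarrow> (nat set \<Rightarrow> real) set \<Rightarrow> nat \<Rightarrow> (nat set \<Rightarrow> real) set \<Rightarrow> bool"
  where "cd_isomorphic n A k B \<longleftrightarrow> (\<exists>f. linear f \<and> bij_betw f A B \<and>
    (\<forall>x\<in>A. \<forall>y\<in>A. f (cd_mult n x y) = cd_mult k (f x) (f y)))"

definition cd_anti_isomorphic ::
  "nat \<Rightarrow> (nat set \<Rightarrow> real) set \<Rightarrow> nat \<Rightarrow> (nat set \<Rightarrow> real) set \<Rightarrow> bool"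
  where "cd_anti_isomorphic n A k B \<longleftrightarrow> (\<exists>f. linear f \<and> bij_betw f A B \<and>
    (\<forall>x\<in>A. \<forall>y\<in>A. f (cd_mult n x y) = cd_mult k (f y) (f x)))"

definition cd_copies :: "nat \<Rightarrow> nat \<Rightarrow> (nat set \<Rightarrow> real) set \<Rightarrow> (nat set \<Rightarrow> real) set set"
  where "cd_copies n k B = {A. cd_subalgebra n A \<and> dim A = 8 \<and>
    (\<exists>T. T \<subseteq> Pow {1..n} - {{}} \<and> card T = 7 \<and> A = span (cd_basis ` insert {} T)) \<and>
    (cd_isomorphic n A k B \<or> cd_anti_isomorphic n A k B)}"

definition P4 :: "(nat set \<Rightarrow> real) set"
  where "P4 = cd_subalgebra 4 hull {cd_basis {1}, cd_basis {2}, cd_basis {3, 4}}"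

definition P12 :: "(nat set \<Rightarrow> real) set"
  where "P12 = cd_subalgebra 5 hull {cd_basis {1}, cd_basis {2, 4}, cd_basis {3, 4, 5}}"

definition P14 :: "(nat set \<Rightarrow> real) set"
  where "P14 = cd_subalgebra 6 hull {cd_basis {1, 4}, cd_basis {2, 5}, cd_basis {3, 6}}"

definition num_octonion_copies :: "nat \<Rightarrow> nat"
  where "num_octonion_copies m = card (cd_copies (m + 3) 3 (cd_space 3))"

text \<open>
  A subalgebra that is a copy of more than one of \<open>P4\<close>, \<open>P12\<close>, \<open>P14\<close> is counted once.
  This matters: as real algebras the three are isomorphic to one another, for instance
  \<open>P4\<close> to \<open>P12\<close> by the linear map fixing \<open>cd_basis {}\<close> and \<open>cd_basis {1}\<close> and sending the
  basis elements with indices \<open>2, 12, 34, 134, 234, 1234\<close> to those with indices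
  \<open>345, 1345, 24, 124, 235, 1235\<close>. So the three families coincide, and adding up their
  three cardinalities would count every copy three times.
\<close>

definition num_quasi_octonion_copies :: "nat \<Rightarrow> nat"
  where "num_quasi_octonion_copies m =
    card (cd_copies (m + 3) 4 P4 \<union> cd_copies (m + 3) 5 P12 \<union> cd_copies (m + 3) 6 P14)"

end

theory Submission
  imports Defs
begin

text \<open>
  Basis elements multiply by \<open>o\<^sub>a o\<^sub>b = \<plusminus> o\<^sub>c\<close> with \<open>c\<close> the symmetric difference of
  \<open>a\<close> and \<open>b\<close>, so the candidate subalgebras correspond to the three-dimensional subspaces of the
  binary vector space of index sets. On such a subspace the signs amount to an orientation of the
  seven lines of a Fano plane. Up to changing signs of basis elements there are eight orientations:
  the octonionic one, and the seven obtained from it by flipping a single line. The latter are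
  permuted transitively by linear maps, so there are exactly two types of subalgebras, and they are
  told apart by alternativity.

  A subspace of the doubled index space either contains the new basis vector, and is then the double
  of a quaternion algebra, hence octonionic; or it is the graph of one of the eight linear
  forms over a subspace \<open>W\<close> of the old index space. In the second case a nonzero form
  reverses all lines except its kernel, which up to equivalence flips only its kernel. So
  whatever the type of \<open>W\<close>, exactly one of its eight lifts is octonionic and seven are not.
\<close>

section \<open>Sign tables on a three-dimensional binary space\<close>

text \<open>The three-dimensional space over the field with two elements. With explicit bits,
  \<open>all_vec\<close> and \<open>ex_vec\<close> split statements about vectors into eight cases
  that the simplifier decides.\<close>

datatype vec = Vec bool bool bool

lemma all_vec: "(\<forall>v. P v) \<longleftrightarrow> P (Vec False False False) \<and> P (Vec True False False) \<and>
    P (Vec False True False) \<and> P (Vec False False True) \<and> P (Vec True True False) \<and>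
    P (Vec True False True) \<and> P (Vec False True True) \<and> P (Vec True True True)"
  by (metis (full_types) vec.exhaust)

lemma ex_vec: "(\<exists>v. P v) \<longleftrightarrow> P (Vec False False False) \<or> P (Vec True False False) \<or>
    P (Vec False True False) \<or> P (Vec False False True) \<or> P (Vec True True False) \<or>
    P (Vec True False True) \<or> P (Vec False True True) \<or> P (Vec True True True)"
  by (metis (full_types) vec.exhaust)

abbreviation zv :: vec where "zv \<equiv> (Vec False False False)"
abbreviation e1 :: vec where "e1 \<equiv> (Vec True False False)"
abbreviation e2 :: vec where "e2 \<equiv> (Vec False True False)"
abbreviation e3 :: vec where "e3 \<equiv> (Vec False False True)"

fun vadd :: "vec \<Rightarrow> vec \<Rightarrow> vec" (infixl "\<oplus>" 65)
  where "Vec a b c \<oplus> Vec d e f = Vec (a \<noteq> d) (b \<noteq> e) (c \<noteq> f)"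

fun dot :: "vec \<Rightarrow> vec \<Rightarrow> bool"
  where "dot (Vec a b c) (Vec d e f) = (((a \<and> d) \<noteq> (b \<and> e)) \<noteq> (c \<and> f))"

definition dep2 :: "vec \<Rightarrow> vec \<Rightarrow> bool"
  where "dep2 p q \<longleftrightarrow> p = zv \<or> q = zv \<or> p = q"

definition dep3 :: "vec \<Rightarrow> vec \<Rightarrow> vec \<Rightarrow> bool"
  where "dep3 p q r \<longleftrightarrow> dep2 p q \<or> r \<in> {zv, p, q, p \<oplus> q}"

text \<open>By the last clause, \<open>t\<close> changes sign under swaps and is fixed under the
  rotation \<open>p\<close>, \<open>q\<close>, \<open>p \<oplus> q\<close>, so a table amounts to an
  orientation of each of the seven lines.\<close>

definition sign_table :: "(vec \<Rightarrow> vec \<Rightarrow> real) \<Rightarrow> bool"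
  where "sign_table t \<longleftrightarrow> (\<forall>p q. t p q = 1 \<or> t p q = -1) \<and> (\<forall>p. t zv p = 1 \<and> t p zv = 1) \<and>
    (\<forall>p. p \<noteq> zv \<longrightarrow> t p p = -1) \<and>
    (\<forall>p q. \<not> dep2 p q \<longrightarrow> t q p = - t p q \<and> t q (p \<oplus> q) = t p q)"

text \<open>The coboundary of the 2-cochain \<open>t\<close>: the sign by which \<open>(pq)r\<close>
  and \<open>p(qr)\<close> differ in the algebra with multiplication signs \<open>t\<close>.\<close>

definition assoc_sign :: "(vec \<Rightarrow> vec \<Rightarrow> real) \<Rightarrow> vec \<Rightarrow> vec \<Rightarrow> vec \<Rightarrow> real"
  where "assoc_sign t p q r = t p q * t (p \<oplus> q) r * t q r * t p (q \<oplus> r)"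

definition octonionic :: "(vec \<Rightarrow> vec \<Rightarrow> real) \<Rightarrow> bool"
  where "octonionic t \<longleftrightarrow> (\<forall>p q r. \<not> dep3 p q r \<longrightarrow> assoc_sign t p q r = -1)"

text \<open>Doubling along the linear form \<open>dot u\<close> multiplies the signs by \<open>kappa u\<close>; see \<open>table_lift\<close>.\<close>

definition kappa :: "vec \<Rightarrow> vec \<Rightarrow> vec \<Rightarrow> real"
  where "kappa u p q = (if dep2 p q \<or> \<not> dot u p \<and> \<not> dot u q then 1 else -1)"

lemma vadd_simps [simp]:
  "p \<oplus> p = zv" "zv \<oplus> p = p" "p \<oplus> zv = p" "p \<oplus> (p \<oplus> q) = q"
  by (cases p; cases q; auto)+

lemma vadd_comm: "p \<oplus> q = q \<oplus> p"
  by (cases p; cases q; auto)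

lemma vadd_assoc: "p \<oplus> q \<oplus> r = p \<oplus> (q \<oplus> r)"
  by (cases p; cases q; cases r; auto)

lemma vadd_left_comm: "p \<oplus> (q \<oplus> r) = q \<oplus> (p \<oplus> r)"
  by (cases p; cases q; cases r; auto)

lemma dot_add: "dot u (p \<oplus> q) = (dot u p \<noteq> dot u q)"
  by (cases u; cases p; cases q; auto)

text \<open>
  The choice of \<open>\<eta>\<close> matches \<open>r\<close> on four of the seven lines; each of the three associativity
  conditions involves exactly one of the remaining lines.
\<close>

lemma symmetric_table_coboundary:
  fixes r :: "vec \<Rightarrow> vec \<Rightarrow> real"
  assumes pm: "\<And>p q. r p q = 1 \<or> r p q = -1"
    and z: "\<And>p. r zv p = 1" and d: "\<And>p. r p p = 1"
    and s: "\<And>p q. r p q = r q p" and l: "\<And>p q. r q (p \<oplus> q) = r p q"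
    and a1: "assoc_sign r e1 e2 e3 = 1"
    and a2: "assoc_sign r e2 e1 e3 = 1"
    and a3: "assoc_sign r e1 e2 (e2 \<oplus> e3) = 1"
  obtains \<eta> where "\<And>p. \<eta> p = 1 \<or> \<eta> p = -1" "\<And>p q. r p q = \<eta> p * \<eta> q * \<eta> (p \<oplus> q)"
proof -
  \<comment> \<open>Multiplying \<eta> by a character does not change its coboundary, so \<eta> may
    be taken to be 1 at zero and at the unit vectors; the remaining values are then forced by
    \<open>r\<close>.\<close>
  define \<eta> :: "vec \<Rightarrow> real" where "\<eta> p = (case p of Vec a b c \<Rightarrow>
    if a then if b then if c then r e1 e2 * r (e1 \<oplus> e2) e3 else r e1 e2 else if c then r e1 e3 else 1
    else if b \<and> c then r e2 e3 else 1)" for p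
  have z': "r p zv = 1" for p using s z by metis
  have l': "r q x = r p q" "r x q = r p q" "r p x = r p q" "r x p = r p q" "r q p = r p q"
    if "x = p \<oplus> q" for p q x
    using that l s vadd_comm by metis+
  note L = l'[of "(Vec True True False)" e1 e2, simplified] l'[of "(Vec True False True)" e1 e3, simplified]
    l'[of "(Vec False True True)" e2 e3, simplified]
    l'[of "(Vec True True True)" "(Vec True True False)" e3, simplified]
    l'[of "(Vec True True True)" e1 "(Vec False True True)", simplified]
    l'[of "(Vec True True True)" e2 "(Vec True False True)", simplified]
    l'[of "(Vec True False True)" "(Vec True True False)" "(Vec False True True)", simplified]
  \<comment> \<open>One name for each of the seven lines; the equations \<open>L\<close> reduce the
    other values of \<open>r\<close> on a line to it.\<close>
  define x1 x2 x3 x4 x5 x6 x7 where x: "x1 = r e1 e2" "x2 = r e1 e3" "x3 = r e2 e3"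
    "x4 = r (Vec True True False) e3" "x5 = r e1 (Vec False True True)" "x6 = r e2 (Vec True False True)"
    "x7 = r (Vec True True False) (Vec False True True)"
  have P: "x1 = 1 \<or> x1 = -1" "x2 = 1 \<or> x2 = -1" "x3 = 1 \<or> x3 = -1" "x4 = 1 \<or> x4 = -1"
    "x5 = 1 \<or> x5 = -1" "x6 = 1 \<or> x6 = -1" "x7 = 1 \<or> x7 = -1"
    unfolding x by (rule pm)+
  have sq1: "x * x = 1" "x * (x * y) = y" if "x = 1 \<or> x = -1" for x y :: real
    using that by auto
  note sq = sq1[OF P(1)] sq1[OF P(2)] sq1[OF P(3)] sq1[OF P(4)]
  \<comment> \<open>The three conditions are solved for \<open>x5\<close>, \<open>x6\<close> and
    \<open>x7\<close>, the lines that the choice of \<eta> does not match by itself.\<close>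
  have "x1 * x4 * x3 * x5 = 1" "x1 * x4 * x2 * x6 = 1" "x1 * x7 * x3 * x2 = 1"
    using a1 a2 a3 by (simp_all add: assoc_sign_def L x[symmetric])
  moreover have y1: "x = y" if "y * x = 1" "x = 1 \<or> x = -1" for x y :: real
    using that by auto
  ultimately have y: "x5 = x1 * x4 * x3" "x6 = x1 * x4 * x2" "x7 = x1 * x3 * x2"
    using P(5-7) by (simp_all add: y1 mult.commute mult.left_commute)
  have \<eta>: "\<eta> zv = 1" "\<eta> e1 = 1" "\<eta> e2 = 1" "\<eta> e3 = 1" "\<eta> (Vec True True False) = x1" "\<eta> (Vec True False True) = x2"
    "\<eta> (Vec False True True) = x3" "\<eta> (Vec True True True) = x1 * x4"
    by (simp_all add: \<eta>_def x)
  have "r p q = \<eta> p * \<eta> q * \<eta> (p \<oplus> q)" for p q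
  proof (cases p; cases q)
    fix a b c d e f assume pq: "p = Vec a b c" "q = Vec d e f"
    show ?thesis unfolding pq
      by (cases a; cases b; cases c; cases d; cases e; cases f;
          simp add: z z' d L x[symmetric] \<eta> y sq mult.commute mult.left_commute)
  qed
  moreover have "\<forall>p. \<eta> p = 1 \<or> \<eta> p = -1"
    unfolding all_vec \<eta> using P by auto
  ultimately show ?thesis using that by blast
qed

section \<open>Equivalence of sign tables under sign changes of basis elements\<close>

lemma sign_tableD:
  assumes "sign_table t"
  shows "t p q = 1 \<or> t p q = -1" "t zv p = 1" "t p zv = 1" "p \<noteq> zv \<Longrightarrow> t p p = -1"
    "\<not> dep2 p q \<Longrightarrow> t q p = - t p q" "\<not> dep2 p q \<Longrightarrow> t q (p \<oplus> q) = t p q"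
  using assms unfolding sign_table_def by blast+

lemma vadd_eq_iff: "p \<oplus> q = zv \<longleftrightarrow> p = q" "p = p \<oplus> q \<longleftrightarrow> q = zv" "q = p \<oplus> q \<longleftrightarrow> p = zv"
  by (cases p; cases q; auto)+

text \<open>The product of two tables is symmetric, constant on each line and 1 on dependent pairs.
  Agreement of the three associators makes those of the product 1, so it is a coboundary. Thus three
  signs classify a table up to equivalence, which leaves at most eight classes.\<close>

lemma sign_table_equiv:
  assumes t: "sign_table t" and t': "sign_table t'"
    and eq: "assoc_sign t e1 e2 e3 = assoc_sign t' e1 e2 e3"
      "assoc_sign t e2 e1 e3 = assoc_sign t' e2 e1 e3"
      "assoc_sign t e1 e2 (e2 \<oplus> e3) = assoc_sign t' e1 e2 (e2 \<oplus> e3)"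
  obtains \<eta> where "\<And>p. \<eta> p = 1 \<or> \<eta> p = -1"
    "\<And>p q. t p q = \<eta> p * \<eta> q * \<eta> (p \<oplus> q) * t' p q"
proof -
  define r where "r p q = t p q * t' p q" for p q
  have pm: "t p q = 1 \<or> t p q = -1" "t' p q = 1 \<or> t' p q = -1" for p q
    using t t' by (blast dest: sign_tableD)+
  have pmr: "r p q = 1 \<or> r p q = -1" for p q
    using pm[of p q] by (auto simp: r_def)
  have z: "r zv p = 1" "r p zv = 1" for p
    using t t' by (auto simp: r_def sign_tableD)
  have d: "r p p = 1" for p
    using t t' by (cases "p = zv") (auto simp: r_def sign_tableD)
  have s: "r p q = r q p" for p q
  proof (cases "dep2 p q")
    case True
    then show ?thesis using z by (auto simp: dep2_def)
  next
    case False
    then have "t q p = - t p q" "t' q p = - t' p q"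
      using t t' by (auto simp: sign_tableD)
    then show ?thesis by (simp add: r_def)
  qed
  have l: "r q (p \<oplus> q) = r p q" for p q
  proof (cases "dep2 p q")
    case True
    then show ?thesis using z d by (auto simp: dep2_def)
  next
    case False
    then have "t q (p \<oplus> q) = t p q" "t' q (p \<oplus> q) = t' p q"
      using t t' by (auto simp: sign_tableD)
    then show ?thesis by (simp add: r_def)
  qed
  have r: "assoc_sign r p q u = assoc_sign t p q u * assoc_sign t' p q u" for p q u
    by (simp add: assoc_sign_def r_def)
  have "assoc_sign t' p q u = 1 \<or> assoc_sign t' p q u = -1" for p q u
    using pm(2)[of p q] pm(2)[of "p \<oplus> q" u] pm(2)[of q u] pm(2)[of p "q \<oplus> u"]
    by (auto simp: assoc_sign_def)
  then have sq: "assoc_sign t' p q u * assoc_sign t' p q u = 1" for p q u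
    by (metis mult_1 mult_minus1 minus_minus)
  have a: "assoc_sign r e1 e2 e3 = 1" "assoc_sign r e2 e1 e3 = 1"
      "assoc_sign r e1 e2 (e2 \<oplus> e3) = 1"
    by (simp_all only: r eq sq)
  obtain \<eta> where \<eta>: "\<And>p. \<eta> p = 1 \<or> \<eta> p = -1" "\<And>p q. r p q = \<eta> p * \<eta> q * \<eta> (p \<oplus> q)"
    by (rule symmetric_table_coboundary[OF pmr z(1) d s l a]) blast
  have "t p q = r p q * t' p q" for p q
    using pm(2)[of p q] by (auto simp: r_def)
  then have "t p q = \<eta> p * \<eta> q * \<eta> (p \<oplus> q) * t' p q" for p q
    by (simp only: \<eta>(2))
  with \<eta>(1) show ?thesis by (rule that)
qed

text \<open>A coboundary has trivial coboundary: after expansion every factor of \<eta> occurs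
  twice.\<close>

lemma assoc_sign_equiv:
  assumes "\<And>p. \<eta> p = 1 \<or> \<eta> p = -1" "\<And>p q. t p q = \<eta> p * \<eta> q * \<eta> (p \<oplus> q) * t' p q"
  shows "assoc_sign t p q r = assoc_sign t' p q r"
proof -
  have sq: "\<eta> x * \<eta> x = 1" "\<eta> x * (\<eta> x * y) = y" for x y
    using assms(1)[of x] by auto
  show ?thesis
    unfolding assoc_sign_def assms(2)
    by (simp add: vadd_assoc sq mult.commute mult.left_commute)
qed

text \<open>The cochain of Albuquerque and Majid presenting the octonions as a twisted group algebra.\<close>

definition oct_table :: "vec \<Rightarrow> vec \<Rightarrow> real"
  where "oct_table p q = (case (p, q) of (Vec a b c, Vec a' b' c') \<Rightarrow>
    if odd (of_bool (a \<and> a') + of_bool (a \<and> b') + of_bool (a \<and> c') + of_bool (b \<and> b')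
      + of_bool (b \<and> c') + of_bool (c \<and> c') + of_bool (a' \<and> b \<and> c) + of_bool (a \<and> b' \<and> c)
      + of_bool (a \<and> b \<and> c') :: nat) then -1 else 1)"

lemma sign_table_oct_table: "sign_table oct_table"
  unfolding sign_table_def dep2_def
  by (simp add: all_vec oct_table_def)

lemma octonionic_oct_table: "octonionic oct_table"
  unfolding octonionic_def dep2_def dep3_def assoc_sign_def
  by (simp add: all_vec oct_table_def)

text \<open>The three signs make \<open>t\<close> equivalent to \<open>oct_table\<close>, and
  equivalence preserves all associators.\<close>

lemma octonionicI:
  assumes t: "sign_table t" and eq: "assoc_sign t e1 e2 e3 = -1"
      "assoc_sign t e2 e1 e3 = -1" "assoc_sign t e1 e2 (e2 \<oplus> e3) = -1"
  shows "octonionic t"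
proof -
  have *: "assoc_sign oct_table p q r = -1" if "\<not> dep3 p q r" for p q r
    using octonionic_oct_table that by (simp add: octonionic_def)
  have "assoc_sign oct_table e1 e2 e3 = -1" "assoc_sign oct_table e2 e1 e3 = -1"
      "assoc_sign oct_table e1 e2 (e2 \<oplus> e3) = -1"
    by (rule *; simp add: dep3_def dep2_def)+
  then obtain \<eta> where \<eta>: "\<And>p. \<eta> p = 1 \<or> \<eta> p = -1"
      "\<And>p q. t p q = \<eta> p * \<eta> q * \<eta> (p \<oplus> q) * oct_table p q"
    using sign_table_equiv[OF t sign_table_oct_table] eq by metis
  have "assoc_sign t p q r = assoc_sign oct_table p q r" for p q r
    using \<eta> by (rule assoc_sign_equiv)
  then show ?thesis using * by (simp add: octonionic_def)
qed

text \<open>\<open>kappa u\<close> depends only on the line through \<open>p\<close> and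
  \<open>q\<close>: it is 1 if \<open>dot u\<close> vanishes on that line and -1 otherwise.
  Multiplying by it therefore reverses whole lines.\<close>

lemma sign_table_kappa:
  assumes t: "sign_table t" shows "sign_table (\<lambda>p q. kappa u p q * t p q)"
proof -
  have "kappa u p q = 1 \<or> kappa u p q = -1" "kappa u zv p = 1" "kappa u p zv = 1" "kappa u p p = 1"
    "kappa u q p = kappa u p q" for p q
    by (auto simp: kappa_def dep2_def)
  moreover have "kappa u q (p \<oplus> q) = kappa u p q" for p q
  proof -
    have "dep2 q (p \<oplus> q) = dep2 p q" by (cases p; cases q) (auto simp: dep2_def)
    then show ?thesis by (auto simp: kappa_def dot_add)
  qed
  ultimately show ?thesis using sign_tableD[OF t] unfolding sign_table_def
    by (smt (verit, ccfv_threshold) mult_cancel_left1 mult_minus1 mult_minus_right)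
qed

lemma assoc_sign_pm:
  assumes t: "sign_table t"
  shows "assoc_sign t p q r = 1 \<or> assoc_sign t p q r = -1"
  using sign_tableD(1)[OF t, of p q] sign_tableD(1)[OF t, of "p \<oplus> q" r]
    sign_tableD(1)[OF t, of q r] sign_tableD(1)[OF t, of p "q \<oplus> r"]
  by (auto simp: assoc_sign_def)

text \<open>Being octonionic prescribes the three classifying signs of \<open>kappa u\<close>, and
  the eight forms realise the eight sign triples bijectively.\<close>

lemma ex1_octonionic_kappa:
  assumes t: "sign_table t" shows "\<exists>!u. octonionic (\<lambda>p q. kappa u p q * t p q)"
proof -
  have mult: "assoc_sign (\<lambda>p q. kappa u p q * t p q) p q r = assoc_sign (kappa u) p q r * assoc_sign t p q r"
    for u p q r by (simp add: assoc_sign_def)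
  note pm = assoc_sign_pm[OF t]
  have neg: "x * y = -1 \<longleftrightarrow> x = - y" if "y = 1 \<or> y = -1" for x y :: real
    using that by auto
  have oct_iff: "octonionic (\<lambda>p q. kappa u p q * t p q) \<longleftrightarrow>
    assoc_sign (kappa u) e1 e2 e3 = - assoc_sign t e1 e2 e3 \<and>
    assoc_sign (kappa u) e2 e1 e3 = - assoc_sign t e2 e1 e3 \<and>
    assoc_sign (kappa u) e1 e2 (e2 \<oplus> e3) = - assoc_sign t e1 e2 (e2 \<oplus> e3)" (is "_ \<longleftrightarrow> ?R") for u
  proof
    assume *: "octonionic (\<lambda>p q. kappa u p q * t p q)"
    have "\<not> dep3 e1 e2 e3" "\<not> dep3 e2 e1 e3" "\<not> dep3 e1 e2 (e2 \<oplus> e3)"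
      by (simp_all add: dep3_def dep2_def)
    then show ?R using * unfolding octonionic_def mult neg[OF pm] by blast
  next
    assume ?R
    then show "octonionic (\<lambda>p q. kappa u p q * t p q)"
      by (intro octonionicI sign_table_kappa[OF t]; simp only: mult neg[OF pm])
  qed
  \<comment> \<open>This bijection is verified by enumerating the eight vectors \<open>u\<close> for
    each sign triple.\<close>
  have "\<exists>!u. assoc_sign (kappa u) e1 e2 e3 = x \<and> assoc_sign (kappa u) e2 e1 e3 = y \<and>
      assoc_sign (kappa u) e1 e2 (e2 \<oplus> e3) = z"
    if "x = 1 \<or> x = -1" "y = 1 \<or> y = -1" "z = 1 \<or> z = -1" for x y z
    using that unfolding Ex1_def all_vec ex_vec
    by (elim disjE; simp add: assoc_sign_def kappa_def dep2_def)
  from this[of "- assoc_sign t e1 e2 e3" "- assoc_sign t e2 e1 e3" "- assoc_sign t e1 e2 (e2 \<oplus> e3)"]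
  show ?thesis unfolding oct_iff
    using pm[of e1 e2 e3] pm[of e2 e1 e3] pm[of e1 e2 "e2 \<oplus> e3"]
    by linarith
qed

text \<open>A dependent triple spans at most a plane, on which the signs are those of the reals, the
  complex numbers or the quaternions, all associative.\<close>

lemma assoc_of_dep3:
  assumes t: "sign_table t" and "dep3 p q r"
  shows "t p q * t (p \<oplus> q) r = t q r * t p (q \<oplus> r)"
proof -
  note D = sign_tableD[OF t]
  have sq: "t x y * t x y = 1" for x y using D(1)[of x y] by auto
  consider "p = zv" | "q = zv" | "r = zv" | "p \<noteq> zv" "r \<noteq> zv" "p = q" "p \<noteq> r" | "p \<noteq> zv" "p = q" "p = r"
    | "\<not> dep2 p q" "r = p" | "\<not> dep2 p q" "r = q" | "\<not> dep2 p q" "r = p \<oplus> q"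
    using assms(2) unfolding dep3_def dep2_def by blast
  then show ?thesis
  proof cases
    case 4
    then have "\<not> dep2 r p" by (auto simp: dep2_def vadd_eq_iff)
    then have "t p (p \<oplus> r) = - t p r" using D(5)[of r p] D(6)[of r p] by (simp add: vadd_comm)
    then show ?thesis using 4 D sq by simp
  next
    case 6
    then have "\<not> dep2 q p" "\<not> dep2 p (p \<oplus> q)" by (auto simp: dep2_def vadd_eq_iff)
    then have "t p (q \<oplus> p) = t q p" "t (p \<oplus> q) p = - t q p"
      using D(5)[of p "p \<oplus> q"] D(6)[of q p] by (simp_all add: vadd_comm)
    then show ?thesis using 6 D(5)[of p q] sq[of p q] by simp
  next
    case 7
    then have "\<not> dep2 q (p \<oplus> q)" by (auto simp: dep2_def vadd_eq_iff vadd_comm)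
    then have "t (p \<oplus> q) q = - t p q" using D(5)[of q "p \<oplus> q"] D(6)[of p q] 7 by simp
    then show ?thesis using 7 D(3,4) sq[of p q] by (simp add: dep2_def)
  next
    case 8
    have "q \<oplus> (p \<oplus> q) = p" by (cases p; cases q) auto
    then show ?thesis using 8 D(4)[of p] D(4)[of "p \<oplus> q"] D(6)[of p q] by (simp add: dep2_def vadd_eq_iff)
  qed (use D sq in auto)
qed

text \<open>The coefficient of the associator of three basis elements, as
  \<open>associator_basis\<close> shows.\<close>

definition assoc_coeff :: "(vec \<Rightarrow> vec \<Rightarrow> real) \<Rightarrow> vec \<Rightarrow> vec \<Rightarrow> vec \<Rightarrow> real"
  where "assoc_coeff t p q r = t p q * t (p \<oplus> q) r - t q r * t p (q \<oplus> r)"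

lemma dep3_perm: "dep3 q p r = dep3 p q r" "dep3 p r q = dep3 p q r"
  by (cases p; cases q; cases r; auto simp: dep3_def dep2_def)+

text \<open>On independent triples the two products are opposite, so the coefficient is twice
  \<open>t p q * t (p \<oplus> q) r\<close> and also minus twice
  \<open>t q r * t p (q \<oplus> r)\<close>. The first form changes sign when \<open>p\<close> and
  \<open>q\<close> are swapped, the second when \<open>q\<close> and \<open>r\<close> are. On
  dependent triples it vanishes.\<close>

lemma assoc_coeff_of_octonionic:
  assumes t: "sign_table t" and o: "octonionic t"
  shows "assoc_coeff t q p r = - assoc_coeff t p q r" "assoc_coeff t p r q = - assoc_coeff t p q r"
proof -
  note D = sign_tableD[OF t]
  have nd: "t x y * t (x \<oplus> y) z = - (t y z * t x (y \<oplus> z))" if "\<not> dep3 x y z" for x y z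
  proof -
    have "t x y * t (x \<oplus> y) z * (t y z * t x (y \<oplus> z)) = -1"
      using o that unfolding octonionic_def assoc_sign_def by (metis mult.assoc)
    then show ?thesis
      using D(1)[of y z] D(1)[of x "y \<oplus> z"] by auto
  qed
  have "assoc_coeff t q p r = - assoc_coeff t p q r \<and> assoc_coeff t p r q = - assoc_coeff t p q r"
  proof (cases "dep3 p q r")
    case True
    then show ?thesis
      using assoc_of_dep3[OF t] dep3_perm by (simp add: assoc_coeff_def)
  next
    case False
    then have "\<not> dep3 q p r" "\<not> dep3 p r q" using dep3_perm by blast+
    moreover from False have "t q p = - t p q" using D(5) by (auto simp: dep3_def)
    moreover from False have "\<not> dep2 q r" by (auto simp: dep3_def dep2_def)
    then have "t r q = - t q r" using D(5) by auto
    ultimately show ?thesis using False nd[of p q r] nd[of q p r] nd[of p r q]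
      by (simp add: assoc_coeff_def vadd_comm)
  qed
  then show "assoc_coeff t q p r = - assoc_coeff t p q r" "assoc_coeff t p r q = - assoc_coeff t p q r"
    by blast+
qed

text \<open>If one independent triple associates, skew symmetry makes its permutations associate
  too. Then \<open>(pq)r = p(qr) = -p(rq) = -(pr)q = (rp)q = r(pq) = -(pq)r\<close>, which is
  impossible.\<close>

lemma octonionic_of_assoc_coeff:
  assumes t: "sign_table t"
    and a: "\<And>p q r. assoc_coeff t q p r = - assoc_coeff t p q r"
      "\<And>p q r. assoc_coeff t p r q = - assoc_coeff t p q r"
  shows "octonionic t"
  unfolding octonionic_def
proof (intro allI impI)
  fix p q r assume nd: "\<not> dep3 p q r"
  note D = sign_tableD[OF t]
  show "assoc_sign t p q r = -1"
  proof (rule ccontr)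
    assume "assoc_sign t p q r \<noteq> -1"
    then have "assoc_coeff t p q r = 0"
      using D(1)[of p q] D(1)[of "p \<oplus> q" r] D(1)[of q r] D(1)[of p "q \<oplus> r"]
      by (auto simp: assoc_sign_def assoc_coeff_def)
    then have "assoc_coeff t p q r = 0" "assoc_coeff t p r q = 0" "assoc_coeff t r p q = 0"
      using a by (metis minus_zero)+
    moreover have "\<not> dep2 p r" "\<not> dep2 q r" "\<not> dep2 (p \<oplus> q) r"
      using nd by (cases p; cases q; cases r; auto simp: dep3_def dep2_def)+
    then have "t r q = - t q r" "t r p = - t p r" "t r (p \<oplus> q) = - t (p \<oplus> q) r"
      using D(5) by auto
    ultimately have "t p q * t (p \<oplus> q) r = 0"
      by (simp add: assoc_coeff_def vadd_comm)
    then show False using D(1)[of p q] D(1)[of "p \<oplus> q" r] by auto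
  qed
qed

text \<open>Moves the flipped line to a standard position, whence all non-octonionic tables are equivalent.\<close>

lemma linear_form_coordinates:
  assumes "u \<noteq> zv"
  obtains \<psi> where "\<And>p q. \<psi> (p \<oplus> q) = \<psi> p \<oplus> \<psi> q" "inj \<psi>" "\<And>v. dot u (\<psi> v) = dot e3 v"
proof -
  \<comment> \<open>A basis adapted to \<open>u\<close>: \<open>p\<close> and \<open>q\<close> span
    the kernel of \<open>dot u\<close>, and \<open>r\<close> lies outside it. The map \<psi> below
    sends the unit vectors to this basis.\<close>
  have *: "\<forall>u. u \<noteq> zv \<longrightarrow> (\<exists>p q r. p \<noteq> zv \<and> q \<noteq> zv \<and> p \<noteq> q \<and> \<not> dot u p \<and> \<not> dot u q \<and> dot u r)"
    unfolding all_vec ex_vec by simp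
  obtain p q r where pqr: "p \<noteq> zv" "q \<noteq> zv" "p \<noteq> q" "\<not> dot u p" "\<not> dot u q" "dot u r"
    using *[rule_format, OF assms] by blast
  define s where "s i v = (if i then v else zv)" for i v
  define \<psi> where "\<psi> v = (case v of Vec a b c \<Rightarrow> s a p \<oplus> s b q \<oplus> s c r)" for v
  have s_add: "s (i = (\<not> j)) v = s i v \<oplus> s j v" for i j v
    by (auto simp: s_def)
  have d0: "\<not> dot u zv" by (cases u) auto
  have add: "\<psi> (x \<oplus> y) = \<psi> x \<oplus> \<psi> y" for x y
    by (cases x; cases y) (simp add: \<psi>_def s_add vadd_assoc vadd_comm vadd_left_comm)
  have dt: "dot u (\<psi> v) = dot e3 v" for v
    using pqr d0 by (cases v) (auto simp: \<psi>_def s_def dot_add)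
  have ker: "v = zv" if "\<psi> v = zv" for v
  proof (cases v)
    case (Vec a b c)
    have "\<not> c" using dt[of v] that d0 Vec by auto
    then have "s a p = s b q" using that Vec unfolding \<psi>_def s_def
      by simp (metis vadd_simps(2,4) vadd_comm)
    then show ?thesis using pqr Vec \<open>\<not> c\<close> by (auto simp: s_def split: if_splits)
  qed
  have "inj \<psi>"
  proof (rule injI)
    fix x y assume "\<psi> x = \<psi> y"
    then have "\<psi> (x \<oplus> y) = zv" by (simp add: add)
    then have "x \<oplus> y = zv" by (rule ker)
    then show "x = y" by (metis vadd_comm vadd_simps(2,4))
  qed
  with add dt that show ?thesis by blast
qed

lemma finite_vec [simp]: "finite (UNIV :: vec set)" and card_vec: "card (UNIV :: vec set) = 8"
proof -
  have *: "(UNIV :: vec set) = {zv, e1, e2, e3, Vec True True False, Vec True False True,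
      Vec False True True, Vec True True True}"
    by (rule UNIV_eq_I) (metis (full_types) insertCI vec.exhaust)
  show "finite (UNIV :: vec set)" unfolding * by simp
  show "card (UNIV :: vec set) = 8" unfolding * by simp
qed

lemma octonionic_comp_iff:
  assumes add: "\<And>p q. \<psi> (p \<oplus> q) = \<psi> p \<oplus> \<psi> q" and "inj \<psi>"
  shows "octonionic (\<lambda>p q. t (\<psi> p) (\<psi> q)) \<longleftrightarrow> octonionic t"
proof -
  have surj: "surj \<psi>" using \<open>inj \<psi>\<close> finite_UNIV_inj_surj finite_vec by blast
  have z: "\<psi> zv = zv" using add[of zv zv] by simp
  have i: "\<psi> x = \<psi> y \<longleftrightarrow> x = y" for x y using \<open>inj \<psi>\<close> by (auto dest: injD)
  have iz: "\<psi> x = zv \<longleftrightarrow> x = zv" for x using i[of x zv] z by simp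
  have dep: "dep3 (\<psi> p) (\<psi> q) (\<psi> r) = dep3 p q r" for p q r
    by (simp add: dep3_def dep2_def i iz add[symmetric])
  have as: "assoc_sign (\<lambda>p q. t (\<psi> p) (\<psi> q)) p q r = assoc_sign t (\<psi> p) (\<psi> q) (\<psi> r)" for p q r
    by (simp add: assoc_sign_def add)
  show ?thesis unfolding octonionic_def as using dep surj
    by (metis surj_def)
qed

section \<open>Multiplication of basis elements\<close>

lemma scaleR_fun_apply: "(c *\<^sub>R f) x = c *\<^sub>R f x" for f :: "'a \<Rightarrow> 'b::real_vector"
  by (simp add: scaleR_fun_def)

lemma sum_fun_apply: "(\<Sum>i\<in>I. f i) x = (\<Sum>i\<in>I. f i x)" for f :: "'i \<Rightarrow> 'a \<Rightarrow> 'b::comm_monoid_add"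
  by (induction I rule: infinite_finite_induct) auto

text \<open>For finite \<open>W\<close> this is the span of the basis elements indexed by
  \<open>W\<close>. Describing it by supports makes membership easy to test and the dependence on
  \<open>W\<close> visibly injective.\<close>

definition cd_supp :: "nat set set \<Rightarrow> (nat set \<Rightarrow> real) set"
  where "cd_supp W = {x. \<forall>a. x a \<noteq> 0 \<longrightarrow> a \<in> W}"

lemma cd_space_eq: "cd_space n = cd_supp (Pow {1..n})"
  by (auto simp: cd_space_def cd_supp_def)

lemma cd_supp_mono: "V \<subseteq> W \<Longrightarrow> cd_supp V \<subseteq> cd_supp W"
  by (auto simp: cd_supp_def)

lemma cd_basis_in_supp [simp]: "cd_basis a \<in> cd_supp W \<longleftrightarrow> a \<in> W"
  by (auto simp: cd_supp_def cd_basis_def)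

lemma inj_cd_supp: "inj cd_supp"
  by (rule injI, rule set_eqI) (metis cd_basis_in_supp)

lemma subspace_cd_supp: "subspace (cd_supp W)"
  unfolding subspace_def cd_supp_def by (force simp: scaleR_fun_apply)

lemma cd_supp_expand:
  assumes "finite W" "x \<in> cd_supp W"
  shows "x = (\<Sum>a\<in>W. x a *\<^sub>R cd_basis a)"
proof
  fix b
  show "x b = (\<Sum>a\<in>W. x a *\<^sub>R cd_basis a) b"
    using assms by (auto simp: scaleR_fun_apply sum_fun_apply cd_basis_def cd_supp_def if_distrib cong: if_cong)
qed

lemma span_cd_basis: "finite W \<Longrightarrow> span (cd_basis ` W) = cd_supp W"
proof
  assume W: "finite W"
  show "span (cd_basis ` W) \<subseteq> cd_supp W"
    by (rule span_minimal) (auto simp: subspace_cd_supp)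
  show "cd_supp W \<subseteq> span (cd_basis ` W)"
  proof
    fix x assume "x \<in> cd_supp W"
    from cd_supp_expand[OF W this] show "x \<in> span (cd_basis ` W)"
      by (metis (mono_tags, lifting) image_eqI span_base span_scale span_sum)
  qed
qed

lemma inj_cd_basis: "inj cd_basis"
  by (rule injI) (metis cd_basis_def zero_neq_one)

lemma independent_cd_basis: assumes "finite W" shows "independent (cd_basis ` W)"
proof (rule independent_if_scalars_zero)
  show "finite (cd_basis ` W)" using assms by simp
next
  fix f x assume *: "(\<Sum>x\<in>cd_basis ` W. f x *\<^sub>R x) = 0" "x \<in> cd_basis ` W"
  then obtain a where a: "a \<in> W" "x = cd_basis a" by blast
  have "(\<Sum>b\<in>W. f (cd_basis b) *\<^sub>R cd_basis b) = (\<Sum>x\<in>cd_basis ` W. f x *\<^sub>R x)"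
    by (subst sum.reindex) (auto intro: inj_on_subset[OF inj_cd_basis])
  then have "(\<Sum>b\<in>W. f (cd_basis b) * cd_basis b a) = 0"
    using *(1) sum_fun_apply[of "\<lambda>b. f (cd_basis b) *\<^sub>R cd_basis b" W a] by (simp add: scaleR_fun_apply)
  moreover have "f (cd_basis b) * cd_basis b a = (if a = b then f (cd_basis b) else 0)" for b
    by (simp add: cd_basis_def)
  ultimately show "f x = 0"
    using a assms by simp
qed

lemma dim_cd_supp: "finite W \<Longrightarrow> dim (cd_supp W) = card W"
  by (metis card_image dim_eq_card_independent dim_span independent_cd_basis inj_cd_basis
      inj_on_subset span_cd_basis subset_UNIV)

lemma cd_pair_add: "cd_pair n (x + x') (y + y') = cd_pair n x y + cd_pair n x' y'"
  and cd_pair_scale: "cd_pair n (c *\<^sub>R x) (c *\<^sub>R y) = c *\<^sub>R cd_pair n x y"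
  and cd_fst_add: "cd_fst n (x + y) = cd_fst n x + cd_fst n y"
  and cd_fst_scale: "cd_fst n (c *\<^sub>R x) = c *\<^sub>R cd_fst n x"
  and cd_snd_add: "cd_snd n (x + y) = cd_snd n x + cd_snd n y"
  and cd_snd_scale: "cd_snd n (c *\<^sub>R x) = c *\<^sub>R cd_snd n x"
  by (auto simp: cd_pair_def cd_fst_def cd_snd_def fun_eq_iff scaleR_fun_apply)

lemma cd_conj_add: "cd_conj n (x + y) = cd_conj n x + cd_conj n y"
  by (induction n arbitrary: x y) (simp_all add: cd_fst_add cd_snd_add cd_pair_add[symmetric])

lemma cd_conj_scale: "cd_conj n (c *\<^sub>R x) = c *\<^sub>R cd_conj n x"
  by (induction n arbitrary: x) (simp_all add: cd_fst_scale cd_snd_scale cd_pair_scale[symmetric])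

lemma cd_mult_add:
  "cd_mult n (x + x') y = cd_mult n x y + cd_mult n x' y"
  "cd_mult n y (x + x') = cd_mult n y x + cd_mult n y x'"
  by (induction n arbitrary: x x' y)
    (simp_all add: cd_fst_add cd_snd_add cd_conj_add cd_pair_add[symmetric] Let_def algebra_simps
      scaleR_left_distrib)

lemma cd_mult_scale:
  "cd_mult n (c *\<^sub>R x) y = c *\<^sub>R cd_mult n x y"
  "cd_mult n y (c *\<^sub>R x) = c *\<^sub>R cd_mult n y x"
  by (induction n arbitrary: x y)
    (simp_all add: cd_fst_scale cd_snd_scale cd_conj_scale cd_pair_scale[symmetric] Let_def algebra_simps
      scaleR_right_diff_distrib scaleR_right_distrib scaleR_fun_apply)

lemma linear_cd_mult_left: "linear (\<lambda>x. cd_mult n x y)"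
  and linear_cd_mult_right: "linear (cd_mult n y)"
  by (auto intro!: linearI simp: cd_mult_add cd_mult_scale)

lemma cd_mult_sum:
  "cd_mult n (\<Sum>i\<in>I. a i *\<^sub>R x i) (\<Sum>j\<in>J. b j *\<^sub>R y j) =
    (\<Sum>i\<in>I. \<Sum>j\<in>J. (a i * b j) *\<^sub>R cd_mult n (x i) (y j))"
proof -
  have L: "cd_mult n (\<Sum>i\<in>I. a i *\<^sub>R x i) z = (\<Sum>i\<in>I. a i *\<^sub>R cd_mult n (x i) z)" for z
    using linear_sum[OF linear_cd_mult_left, where g = "\<lambda>i. a i *\<^sub>R x i"] by (simp add: cd_mult_scale)
  have R: "cd_mult n z (\<Sum>j\<in>J. b j *\<^sub>R y j) = (\<Sum>j\<in>J. b j *\<^sub>R cd_mult n z (y j))" for z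
    using linear_sum[OF linear_cd_mult_right, where g = "\<lambda>j. b j *\<^sub>R y j"] by (simp add: cd_mult_scale)
  show ?thesis by (simp only: L, simp only: R scaleR_sum_right scaleR_scaleR)
qed

section \<open>Index sets as a binary vector space, and the signs of basis products\<close>

definition symdiff :: "nat set \<Rightarrow> nat set \<Rightarrow> nat set" (infixl "\<triangle>" 65)
  where "a \<triangle> b = {x. (x \<in> a) \<noteq> (x \<in> b)}"

lemma symdiff_simps [simp]: "a \<triangle> {} = a" "{} \<triangle> a = a" "a \<triangle> a = {}" "a \<triangle> (a \<triangle> b) = b"
  by (auto simp: symdiff_def)

lemma symdiff_comm: "a \<triangle> b = b \<triangle> a"
  and symdiff_assoc: "a \<triangle> b \<triangle> c = a \<triangle> (b \<triangle> c)"
  and symdiff_left_comm: "a \<triangle> (b \<triangle> c) = b \<triangle> (a \<triangle> c)"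
  by (auto simp: symdiff_def)

lemmas symdiff_ac = symdiff_comm symdiff_assoc symdiff_left_comm

lemma symdiff_eq_empty [simp]: "a \<triangle> b = {} \<longleftrightarrow> a = b"
  by (auto simp: symdiff_def)

lemma symdiff_subset: "a \<subseteq> S \<Longrightarrow> b \<subseteq> S \<Longrightarrow> a \<triangle> b \<subseteq> S"
  by (auto simp: symdiff_def)

definition conj_sign :: "nat set \<Rightarrow> real"
  where "conj_sign a = (if a = {} then 1 else -1)"

primrec cd_sign :: "nat \<Rightarrow> nat set \<Rightarrow> nat set \<Rightarrow> real" where
  "cd_sign 0 a b = 1"
| "cd_sign (Suc n) a b = (let a' = a - {Suc n}; b' = b - {Suc n} in
    if Suc n \<in> a then if Suc n \<in> b then - conj_sign b' * cd_sign n b' a' else conj_sign b' * cd_sign n a' b'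
    else if Suc n \<in> b then cd_sign n b' a' else cd_sign n a' b')"

lemma subset_Icc_cases:
  assumes "a \<subseteq> {1..Suc n}"
  obtains (out) "a \<subseteq> {1..n}" "Suc n \<notin> a"
    | (into) b where "b \<subseteq> {1..n}" "Suc n \<notin> b" "a = insert (Suc n) b"
proof (cases "Suc n \<in> a")
  case True
  then have "a - {Suc n} \<subseteq> {1..n}" "a = insert (Suc n) (a - {Suc n})"
    using assms subset_Icc_Suc by auto
  then show ?thesis using into by (metis Diff_iff singletonI)
next
  case False
  then show ?thesis using assms subset_Icc_Suc[of a n] out by simp
qed

lemma cd_sign_Suc:
  assumes "Suc n \<notin> a" "Suc n \<notin> b"
  shows "cd_sign (Suc n) a b = cd_sign n a b"
    "cd_sign (Suc n) a (insert (Suc n) b) = cd_sign n b a"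
    "cd_sign (Suc n) (insert (Suc n) a) b = conj_sign b * cd_sign n a b"
    "cd_sign (Suc n) (insert (Suc n) a) (insert (Suc n) b) = - conj_sign b * cd_sign n b a"
  using assms by (simp_all add: Let_def)

lemma cd_basis_in_space: "a \<subseteq> {1..n} \<Longrightarrow> cd_basis a \<in> cd_space n"
  by (simp add: cd_space_eq)

lemma zero_in_space: "0 \<in> cd_space n"
  by (simp add: cd_space_def)

lemma cd_conj_zero [simp]: "cd_conj n 0 = 0"
  using cd_conj_scale[of n 0 0] by simp

lemma cd_mult_zero [simp]: "cd_mult n 0 x = 0" "cd_mult n x 0 = 0"
  using cd_mult_scale(1)[of n 0 0 x] cd_mult_scale(2)[of n x 0 0] by simp_all

lemma cd_conj_basis: "a \<subseteq> {1..n} \<Longrightarrow> cd_conj n (cd_basis a) = conj_sign a *\<^sub>R cd_basis a"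
proof (induction n arbitrary: a)
  case 0
  then show ?case by (simp add: conj_sign_def)
next
  case (Suc n)
  from Suc.prems show ?case
  proof (cases rule: subset_Icc_cases)
    case out
    have "cd_conj (Suc n) (cd_basis a) = cd_conj (Suc n) (cd_pair n (cd_basis a) 0)"
      using cd_basis_fst[OF out(1)] by simp
    also have "\<dots> = cd_pair n (conj_sign a *\<^sub>R cd_basis a) (conj_sign a *\<^sub>R 0)"
      using cd_conj_pair[OF cd_basis_in_space[OF out(1)] zero_in_space] Suc.IH[OF out(1)]
      by (simp del: cd_conj.simps)
    finally show ?thesis
      unfolding cd_pair_scale using cd_basis_fst[OF out(1)] by simp
  next
    case (into b)
    have "cd_conj (Suc n) (cd_basis a) = cd_conj (Suc n) (cd_pair n 0 (cd_basis b))"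
      using cd_basis_snd[OF into(1)] into(3) by simp
    also have "\<dots> = cd_pair n ((-1) *\<^sub>R 0) ((-1) *\<^sub>R cd_basis b)"
      using cd_conj_pair[OF zero_in_space cd_basis_in_space[OF into(1)]]
      by (simp del: cd_conj.simps)
    finally show ?thesis
      unfolding cd_pair_scale using cd_basis_snd[OF into(1)] into(3) by (simp add: conj_sign_def)
  qed
qed

lemma symdiff_insert:
  assumes "x \<notin> a" "x \<notin> b"
  shows "insert x a \<triangle> b = insert x (a \<triangle> b)" "a \<triangle> insert x b = insert x (a \<triangle> b)"
    "insert x a \<triangle> insert x b = a \<triangle> b" "x \<notin> a \<triangle> b"
  using assms by (auto simp: symdiff_def)

lemma cd_mult_basis:
  assumes "a \<subseteq> {1..n}" "b \<subseteq> {1..n}"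
  shows "cd_mult n (cd_basis a) (cd_basis b) = cd_sign n a b *\<^sub>R cd_basis (a \<triangle> b)"
  using assms
proof (induction n arbitrary: a b)
  case 0
  then show ?case by (simp add: cd_basis_def scaleR_fun_def)
next
  case (Suc n)
  note in_sp = cd_basis_in_space zero_in_space
  \<comment> \<open>One instance of the product formula for each placement of the zero
    components.\<close>
  note M = cd_mult_pair[of _ n, OF in_sp(1) in_sp(2) in_sp(1) in_sp(2)]
    cd_mult_pair[of _ n, OF in_sp(1) in_sp(2) in_sp(2) in_sp(1)]
    cd_mult_pair[of _ n, OF in_sp(2) in_sp(1) in_sp(1) in_sp(2)]
    cd_mult_pair[of _ n, OF in_sp(2) in_sp(1) in_sp(2) in_sp(1)]
  have fst: "cd_pair n (c *\<^sub>R cd_basis x) 0 = c *\<^sub>R cd_basis x" if "x \<subseteq> {1..n}" for c x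
    using cd_pair_scale[of n c "cd_basis x" 0] cd_basis_fst[OF that] by simp
  have snd: "cd_pair n 0 (c *\<^sub>R cd_basis x) = c *\<^sub>R cd_basis (insert (Suc n) x)" if "x \<subseteq> {1..n}" for c x
    using cd_pair_scale[of n c 0 "cd_basis x"] cd_basis_snd[OF that] by simp
  from Suc.prems(1) show ?case
  proof (cases rule: subset_Icc_cases)
    case a: out
    from Suc.prems(2) show ?thesis
    proof (cases rule: subset_Icc_cases)
      case b: out
      then show ?thesis
        using a M(1)[of a b] Suc.IH[of a b] fst[of "a \<triangle> b"]
        by (simp add: cd_basis_fst[symmetric] symdiff_subset cd_sign_Suc del: cd_mult.simps cd_sign.simps)
    next
      case b: (into b')
      then show ?thesis
        using a M(2)[of a b'] Suc.IH[of b' a] snd[of "a \<triangle> b'"]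
        by (simp add: cd_basis_fst[symmetric] cd_basis_snd[symmetric] symdiff_subset symdiff_comm[of b' a]
            cd_sign_Suc symdiff_insert del: cd_mult.simps cd_sign.simps)
    qed
  next
    case a: (into a')
    from Suc.prems(2) show ?thesis
    proof (cases rule: subset_Icc_cases)
      case b: out
      then show ?thesis
        using a M(3)[of a' b] Suc.IH[of a' b] snd[of "a' \<triangle> b"]
        by (simp add: cd_basis_fst[symmetric] cd_basis_snd[symmetric] symdiff_subset cd_conj_basis cd_mult_scale
            cd_sign_Suc symdiff_insert del: cd_mult.simps cd_sign.simps)
    next
      case b: (into b')
      have "- (c *\<^sub>R x) = (- c) *\<^sub>R x" for c and x :: "nat set \<Rightarrow> real" by simp
      then show ?thesis
        using a b M(4)[of a' b'] Suc.IH[of b' a'] fst[of "a' \<triangle> b'"]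
        by (simp add: cd_basis_snd[symmetric] symdiff_subset symdiff_comm[of b' a'] cd_conj_basis cd_mult_scale
            cd_sign_Suc symdiff_insert del: cd_mult.simps cd_sign.simps scaleR_minus_left)
    qed
  qed
qed

lemma cd_sign_pm: "cd_sign n a b = 1 \<or> cd_sign n a b = -1"
  by (induction n arbitrary: a b) (auto simp: Let_def conj_sign_def)

lemma cd_sign_empty: "cd_sign n a {} = 1 \<and> cd_sign n {} a = 1"
  by (induction n arbitrary: a) (auto simp: Let_def conj_sign_def)

lemma cd_sign_self:
  assumes "a \<subseteq> {1..n}" "a \<noteq> {}" shows "cd_sign n a a = -1"
  using assms
proof (induction n arbitrary: a)
  case (Suc n)
  from Suc.prems(1) show ?case
  proof (cases rule: subset_Icc_cases)
    case out
    then show ?thesis using Suc by (simp add: cd_sign_Suc del: cd_sign.simps)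
  next
    case (into b)
    then show ?thesis using Suc.IH[of b]
      by (cases "b = {}") (simp_all add: cd_sign_Suc conj_sign_def cd_sign_empty del: cd_sign.simps)
  qed
qed simp

lemma cd_sign_anticommute:
  assumes "a \<subseteq> {1..n}" "b \<subseteq> {1..n}" "a \<noteq> {}" "b \<noteq> {}" "a \<noteq> b"
  shows "cd_sign n b a = - cd_sign n a b"
  using assms
proof (induction n arbitrary: a b)
  case (Suc n)
  note S = cd_sign_Suc conj_sign_def cd_sign_empty cd_sign_self
  from Suc.prems(1) show ?case
  proof (cases rule: subset_Icc_cases)
    case a: out
    from Suc.prems(2) show ?thesis
    proof (cases rule: subset_Icc_cases)
      case b: out
      then show ?thesis using a Suc.prems Suc.IH[of a b] by (simp add: S del: cd_sign.simps)
    next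
      case b: (into b')
      then show ?thesis using a Suc.prems Suc.IH[of a b'] by (simp add: S del: cd_sign.simps)
    qed
  next
    case a: (into a')
    from Suc.prems(2) show ?thesis
    proof (cases rule: subset_Icc_cases)
      case b: out
      then show ?thesis using a Suc.prems Suc.IH[of a' b] by (simp add: S del: cd_sign.simps)
    next
      case b: (into b')
      then have "a' \<noteq> b'" using a Suc.prems(5) by auto
      with b show ?thesis using a Suc.prems(1,2) Suc.IH[of a' b']
        by (cases "a' = {}"; cases "b' = {}") (simp_all add: S del: cd_sign.simps)
    qed
  qed
qed simp

text \<open>Two distinct imaginary basis elements behave like quaternion units, whose products are
  invariant under rotation. In the induction, deleting \<open>Suc n\<close> can make an index empty
  or two indices equal; there the rules for the unit and for squares replace the induction
  hypothesis.\<close>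

lemma cd_sign_cyclic:
  assumes "a \<subseteq> {1..n}" "b \<subseteq> {1..n}" "a \<noteq> {}" "b \<noteq> {}" "a \<noteq> b"
  shows "cd_sign n b (a \<triangle> b) = cd_sign n a b"
  using assms
proof (induction n arbitrary: a b)
  case (Suc n)
  note S = cd_sign_Suc conj_sign_def cd_sign_empty cd_sign_self symdiff_insert symdiff_subset
  have ne: "a \<triangle> b \<noteq> a" "a \<triangle> b \<noteq> b" if "a \<noteq> {}" "b \<noteq> {}" for a b
    using that by (metis symdiff_comm symdiff_eq_empty symdiff_simps(4))+
  note IH = Suc.IH and anti = cd_sign_anticommute[of _ n]
  from Suc.prems(1) show ?case
  proof (cases rule: subset_Icc_cases)
    case a: out
    from Suc.prems(2) show ?thesis
    proof (cases rule: subset_Icc_cases)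
      case b: out
      then show ?thesis using a Suc by (simp add: S del: cd_sign.simps)
    next
      case b: (into b')
      then show ?thesis using a Suc.prems IH[of a b'] anti[of a b'] anti[of b' "a \<triangle> b'"] ne[of a b']
        by (cases "b' = {}"; cases "a = b'") (simp_all add: S del: cd_sign.simps)
    qed
  next
    case a: (into a')
    from Suc.prems(2) show ?thesis
    proof (cases rule: subset_Icc_cases)
      case b: out
      then show ?thesis using a Suc.prems IH[of a' b] anti[of a' b] anti[of b "a' \<triangle> b"] ne[of a' b]
        by (cases "a' = {}"; cases "a' = b") (simp_all add: S del: cd_sign.simps)
    next
      case b: (into b')
      then have "a' \<noteq> b'" using a Suc.prems(5) by auto
      with b show ?thesis using a Suc.prems(1,2) IH[of a' b'] anti[of a' b'] anti[of b' "a' \<triangle> b'"] ne[of a' b']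
        by (cases "a' = {}"; cases "b' = {}") (simp_all add: S del: cd_sign.simps)
    qed
  qed
qed simp

section \<open>Copies as three-dimensional binary subspaces\<close>

text \<open>A basis of \<open>W\<close>, packaged as a linear isomorphism from \<open>vec\<close>;
  over the field with two elements additivity is linearity.\<close>

definition frame :: "(vec \<Rightarrow> nat set) \<Rightarrow> nat set set \<Rightarrow> bool"
  where "frame \<phi> W \<longleftrightarrow> (\<forall>p q. \<phi> (p \<oplus> q) = \<phi> p \<triangle> \<phi> q) \<and> inj \<phi> \<and> range \<phi> = W"

definition table :: "nat \<Rightarrow> (vec \<Rightarrow> nat set) \<Rightarrow> vec \<Rightarrow> vec \<Rightarrow> real"
  where "table n \<phi> p q = cd_sign n (\<phi> p) (\<phi> q)"

lemma frameD:
  assumes "frame \<phi> W"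
  shows "\<phi> (p \<oplus> q) = \<phi> p \<triangle> \<phi> q" "inj \<phi>" "range \<phi> = W" "\<phi> p \<in> W" "\<phi> zv = {}"
    "\<phi> p = \<phi> q \<longleftrightarrow> p = q" "\<phi> p = {} \<longleftrightarrow> p = zv" "finite W" "card W = 8"
    "a \<in> W \<Longrightarrow> b \<in> W \<Longrightarrow> a \<triangle> b \<in> W"
proof -
  show add: "\<phi> (p \<oplus> q) = \<phi> p \<triangle> \<phi> q" for p q using assms by (simp add: frame_def)
  show i: "inj \<phi>" and r: "range \<phi> = W" using assms by (auto simp: frame_def)
  show "\<phi> p \<in> W" using r by blast
  show z: "\<phi> zv = {}" using add[of zv zv] by simp
  show "\<phi> p = \<phi> q \<longleftrightarrow> p = q" for p q using i by (auto dest: injD)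
  from this[of p zv] show "\<phi> p = {} \<longleftrightarrow> p = zv" using z by simp
  show "finite W" using r finite_vec by blast
  show "card W = 8" using r i card_vec by (metis card_image)
  show "a \<in> W \<Longrightarrow> b \<in> W \<Longrightarrow> a \<triangle> b \<in> W" using r add by (metis imageE rangeI)
qed

lemma sign_table_table:
  assumes f: "frame \<phi> W" and W: "W \<subseteq> Pow {1..n}"
  shows "sign_table (table n \<phi>)"
proof -
  have sub: "\<phi> p \<subseteq> {1..n}" for p using frameD(4)[OF f] W by blast
  have "cd_sign n (\<phi> q) (\<phi> p) = - cd_sign n (\<phi> p) (\<phi> q)"
    "cd_sign n (\<phi> q) (\<phi> p \<triangle> \<phi> q) = cd_sign n (\<phi> p) (\<phi> q)" if "\<not> dep2 p q" for p q
    using that cd_sign_anticommute[OF sub[of p] sub[of q]] cd_sign_cyclic[OF sub[of p] sub[of q]]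
    by (simp_all add: frameD(6,7)[OF f] dep2_def)
  moreover have "cd_sign n (\<phi> p) (\<phi> p) = -1" if "p \<noteq> zv" for p
    using that cd_sign_self[OF sub] by (simp add: frameD(7)[OF f])
  ultimately show ?thesis unfolding sign_table_def table_def frameD(1,5)[OF f]
    using cd_sign_pm cd_sign_empty by blast
qed

text \<open>The linear map that sends the unit vectors to \<open>a\<close>, \<open>b\<close> and
  \<open>c\<close>.\<close>

definition comb :: "nat set \<Rightarrow> nat set \<Rightarrow> nat set \<Rightarrow> vec \<Rightarrow> nat set"
  where "comb a b c v = (case v of Vec i j k \<Rightarrow>
    (if i then a else {}) \<triangle> (if j then b else {}) \<triangle> (if k then c else {}))"

lemma comb_simps [simp]: "comb a b c (Vec i j k) =
    (if i then a else {}) \<triangle> (if j then b else {}) \<triangle> (if k then c else {})"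
  by (simp add: comb_def)

lemma comb_add: "comb a b c (p \<oplus> q) = comb a b c p \<triangle> comb a b c q"
proof (cases p; cases q)
  fix i j k i' j' k' assume *: "p = Vec i j k" "q = Vec i' j' k'"
  have "(if x = (\<not> y) then s else {}) = (if x then s else {}) \<triangle> (if y then s else {})" for x y and s :: "nat set"
    by auto
  then show ?thesis by (simp add: * symdiff_ac del: if_split)
qed

lemma frame_comb:
  assumes "a \<noteq> {}" "b \<noteq> {}" "a \<noteq> b" "c \<notin> {{}, a, b, a \<triangle> b}"
  shows "frame (comb a b c) (range (comb a b c))"
proof -
  have "v = zv" if "comb a b c v = {}" for v
    using that assms by (cases v) (auto split: if_splits)
  then have "p = q" if "comb a b c p = comb a b c q" for p q
    using that by (metis comb_add symdiff_eq_empty vadd_eq_iff(1))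
  then show ?thesis by (auto simp: frame_def comb_add intro: injI)
qed

text \<open>These are the three-dimensional subspaces: since \<open>a \<triangle> a = {}\<close>, a
  nonempty set closed under \<triangle> contains zero, and each element is its own inverse.\<close>

definition subgroups8 :: "nat \<Rightarrow> nat set set set"
  where "subgroups8 n = {W. W \<subseteq> Pow {1..n} \<and> card W = 8 \<and> (\<forall>a\<in>W. \<forall>b\<in>W. a \<triangle> b \<in> W)}"

lemma subgroups8_frame: "frame \<phi> W \<Longrightarrow> W \<subseteq> Pow {1..n} \<Longrightarrow> W \<in> subgroups8 n"
  using frameD[of \<phi> W] by (auto simp: subgroups8_def)

lemma finite_subgroups8: "finite (subgroups8 n)"
  by (rule finite_subset[of _ "Pow (Pow {1..n})"]) (auto simp: subgroups8_def)

lemma frame_comb_subgroups8: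
  assumes W: "W \<in> subgroups8 n" and abc: "a \<in> W" "b \<in> W" "c \<in> W"
    and ind: "a \<noteq> {}" "b \<noteq> {}" "a \<noteq> b" "c \<notin> {{}, a, b, a \<triangle> b}"
  shows "frame (comb a b c) W"
proof -
  have cl: "x \<triangle> y \<in> W" if "x \<in> W" "y \<in> W" for x y using that W by (auto simp: subgroups8_def)
  have e: "{} \<in> W" using cl[OF abc(1) abc(1)] by simp
  note f = frame_comb[OF ind]
  have sub: "range (comb a b c) \<subseteq> W"
  proof
    fix x assume "x \<in> range (comb a b c)"
    then obtain i j k where "x = comb a b c (Vec i j k)" by (metis imageE vec.exhaust)
    then show "x \<in> W" using abc e cl by auto
  qed
  have fin: "finite W" "card W = 8" using W by (auto simp: subgroups8_def intro: card_ge_0_finite)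
  have "range (comb a b c) = W"
    using card_subset_eq[OF fin(1) sub] frameD(9)[OF f] fin(2) by simp
  with f show ?thesis by simp
qed

lemma ex_in_not_in_if_card_8:
  assumes "card W = 8" "finite S" "card S < 8"
  obtains x where "x \<in> W" "x \<notin> S"
  using assms by (metis card_mono linorder_not_le subsetI)

text \<open>A basis is chosen greedily: the spans of no, one and two vectors have at most 1, 2 and 4
  elements, so \<open>W\<close> has a vector outside each.\<close>

lemma subgroups8_obtain_frame:
  assumes W: "W \<in> subgroups8 n"
  obtains \<phi> where "frame \<phi> W"
proof -
  have c: "card W = 8" using W by (simp add: subgroups8_def)
  obtain a where a: "a \<in> W" "a \<notin> {{}}" by (rule ex_in_not_in_if_card_8[OF c, of "{{}}"]) auto
  have "card {{}, a} < 8" by (simp add: card_insert_if)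
  then obtain b where b: "b \<in> W" "b \<notin> {{}, a}" by (rule ex_in_not_in_if_card_8[OF c, rotated]) auto
  have "card {{}, a, b, a \<triangle> b} < 8" by (simp add: card_insert_if)
  then obtain d where d: "d \<in> W" "d \<notin> {{}, a, b, a \<triangle> b}" by (rule ex_in_not_in_if_card_8[OF c, rotated]) auto
  from frame_comb_subgroups8[OF W a(1) b(1) d(1)] a b d that show ?thesis by blast
qed

lemma cd_mult_in_supp:
  assumes W: "W \<in> subgroups8 n" and x: "x \<in> cd_supp W" and y: "y \<in> cd_supp W"
  shows "cd_mult n x y \<in> cd_supp W"
proof -
  have fin: "finite W" using W by (auto simp: subgroups8_def intro: card_ge_0_finite)
  have sub: "a \<subseteq> {1..n}" if "a \<in> W" for a using W that by (auto simp: subgroups8_def)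
  have cl: "a \<triangle> b \<in> W" if "a \<in> W" "b \<in> W" for a b using that W by (auto simp: subgroups8_def)
  have "cd_mult n x y = cd_mult n (\<Sum>a\<in>W. x a *\<^sub>R cd_basis a) (\<Sum>b\<in>W. y b *\<^sub>R cd_basis b)"
    using cd_supp_expand[OF fin] x y by metis
  also have "\<dots> \<in> cd_supp W" unfolding cd_mult_sum
    by (intro subspace_sum subspace_scale subspace_cd_supp)
      (simp add: cd_mult_basis[OF sub sub] subspace_scale[OF subspace_cd_supp] cl)
  finally show ?thesis .
qed

lemma cd_subalgebra_supp:
  assumes W: "W \<in> subgroups8 n"
  shows "cd_subalgebra n (cd_supp W)"
proof -
  obtain \<phi> where f: "frame \<phi> W" using W subgroups8_obtain_frame by blast
  have "{} \<in> W" using frameD(4)[OF f, of zv] frameD(5)[OF f] by simp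
  moreover have "cd_supp W \<subseteq> cd_space n"
    unfolding cd_space_eq using W by (intro cd_supp_mono) (simp add: subgroups8_def)
  ultimately show ?thesis
    using cd_mult_in_supp[OF W] subspace_cd_supp by (simp add: cd_subalgebra_def)
qed

text \<open>The product of two basis elements is a nonzero multiple of the one indexed by the sum,
  so closure under multiplication forces closure of the index set.\<close>

lemma subgroups8_if_subalgebra:
  assumes A: "cd_subalgebra n (cd_supp W)" and W: "W \<subseteq> Pow {1..n}" "card W = 8"
  shows "W \<in> subgroups8 n"
proof -
  have "a \<triangle> b \<in> W" if "a \<in> W" "b \<in> W" for a b
  proof -
    have "cd_mult n (cd_basis a) (cd_basis b) \<in> cd_supp W"
      using A that by (simp add: cd_subalgebra_def)
    then have "cd_sign n a b *\<^sub>R cd_basis (a \<triangle> b) \<in> cd_supp W"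
      using cd_mult_basis that W by (metis PowD subsetD)
    moreover have "(cd_sign n a b *\<^sub>R cd_basis (a \<triangle> b)) (a \<triangle> b) \<noteq> 0"
      using cd_sign_pm[of n a b] by (auto simp: scaleR_fun_apply cd_basis_def)
    ultimately show ?thesis unfolding cd_supp_def by blast
  qed
  with W show ?thesis by (simp add: subgroups8_def)
qed

text \<open>Takes \<open>W\<close> to be \<open>insert {} T\<close>. The conditions on dimension,
  span and subalgebra then say precisely that \<open>W\<close> is a three-dimensional subspace, and
  only the isomorphism type remains to be decided.\<close>

lemma cd_copies_eq:
  "cd_copies n k B = cd_supp ` {W \<in> subgroups8 n. cd_isomorphic n (cd_supp W) k B \<or> cd_anti_isomorphic n (cd_supp W) k B}"
    (is "?L = cd_supp ` ?R")
proof
  show "?L \<subseteq> cd_supp ` ?R"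
  proof
    fix A assume A: "A \<in> ?L"
    then obtain T where T: "T \<subseteq> Pow {1..n} - {{}}" "card T = 7" "A = span (cd_basis ` insert {} T)"
      by (auto simp: cd_copies_def)
    let ?W = "insert {} T"
    have fin: "finite T" using T(2) card_ge_0_finite by force
    then have "card ?W = 8" "?W \<subseteq> Pow {1..n}" using T by (auto simp: card_insert_if)
    moreover have "A = cd_supp ?W" using T(3) span_cd_basis fin by blast
    moreover have "cd_subalgebra n A" "cd_isomorphic n A k B \<or> cd_anti_isomorphic n A k B"
      using A by (simp_all add: cd_copies_def)
    ultimately show "A \<in> cd_supp ` ?R" using subgroups8_if_subalgebra by blast
  qed
  show "cd_supp ` ?R \<subseteq> ?L"
  proof
    fix A assume "A \<in> cd_supp ` ?R"
    then obtain W where W: "W \<in> subgroups8 n" "A = cd_supp W"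
      "cd_isomorphic n A k B \<or> cd_anti_isomorphic n A k B" by blast
    obtain \<phi> where f: "frame \<phi> W" using W(1) subgroups8_obtain_frame by blast
    have fin: "finite W" "card W = 8" "{} \<in> W" using frameD[OF f] by metis+
    have sub: "W \<subseteq> Pow {1..n}" using W(1) by (simp add: subgroups8_def)
    have "dim A = 8" using dim_cd_supp fin W(2) by simp
    moreover have "A = span (cd_basis ` insert {} (W - {{}}))"
      using span_cd_basis[OF fin(1)] W(2) fin(3) by (simp add: insert_absorb)
    moreover have "card (W - {{}}) = 7" "W - {{}} \<subseteq> Pow {1..n} - {{}}" using fin sub by auto
    ultimately have "\<exists>T. T \<subseteq> Pow {1..n} - {{}} \<and> card T = 7 \<and> A = span (cd_basis ` insert {} T)"
      by blast
    with \<open>dim A = 8\<close> cd_subalgebra_supp[OF W(1)] W(2,3) show "A \<in> ?L" by (simp add: cd_copies_def)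
  qed
qed

section \<open>Alternativity as an invariant of copies\<close>

definition alternative :: "nat \<Rightarrow> (nat set \<Rightarrow> real) set \<Rightarrow> bool"
  where "alternative n A \<longleftrightarrow> (\<forall>x\<in>A. \<forall>y\<in>A. cd_mult n (cd_mult n x x) y = cd_mult n x (cd_mult n x y) \<and>
    cd_mult n (cd_mult n y x) x = cd_mult n y (cd_mult n x x))"

text \<open>An anti-isomorphism exchanges the left and right alternative laws, and
  \<open>alternative\<close> contains both.\<close>

lemma alternative_isomorphic:
  assumes A: "cd_subalgebra n A" and iso: "cd_isomorphic n A k B \<or> cd_anti_isomorphic n A k B"
  shows "alternative n A \<longleftrightarrow> alternative k B"
proof -
  have cl: "cd_mult n x y \<in> A" if "x \<in> A" "y \<in> A" for x y using A that by (auto simp: cd_subalgebra_def)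
  from iso obtain f where f: "bij_betw f A B" and
    "(\<forall>x\<in>A. \<forall>y\<in>A. f (cd_mult n x y) = cd_mult k (f x) (f y)) \<or>
     (\<forall>x\<in>A. \<forall>y\<in>A. f (cd_mult n x y) = cd_mult k (f y) (f x))" (is "?H \<or> ?AH")
    unfolding cd_isomorphic_def cd_anti_isomorphic_def by blast
  have B: "B = f ` A" using f by (simp add: bij_betw_def)
  have eq: "x = y \<longleftrightarrow> f x = f y" if "x \<in> A" "y \<in> A" for x y
    using f that by (auto simp: bij_betw_def dest: inj_onD)
  from \<open>?H \<or> ?AH\<close> show ?thesis
  proof
    assume ?H
    then show ?thesis unfolding B alternative_def ball_simps by (simp add: eq cl)
  next
    assume ?AH
    then show ?thesis unfolding B alternative_def ball_simps by (simp add: eq cl) (metis)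
  qed
qed

section \<open>Alternativity and the two isomorphism types\<close>

lemma cd_supp_induct:
  assumes "frame \<phi> W" "x \<in> cd_supp W" "subspace {x. P x}" "\<And>v. P (cd_basis (\<phi> v))"
  shows "P x"
proof -
  have "cd_supp W = span (cd_basis ` W)" using span_cd_basis frameD(8)[OF assms(1)] by simp
  then have "x \<in> span (cd_basis ` W)" using assms(2) by simp
  then show ?thesis
    by (rule span_induct) (use assms frameD(3)[OF assms(1)] in auto)
qed

definition associator :: "nat \<Rightarrow> (nat set \<Rightarrow> real) \<Rightarrow> (nat set \<Rightarrow> real) \<Rightarrow> (nat set \<Rightarrow> real) \<Rightarrow> (nat set \<Rightarrow> real)"
  where "associator n x y z = cd_mult n (cd_mult n x y) z - cd_mult n x (cd_mult n y z)"

lemma associator_add: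
  "associator n (x + x') y z = associator n x y z + associator n x' y z"
  "associator n y (x + x') z = associator n y x z + associator n y x' z"
  "associator n y z (x + x') = associator n y z x + associator n y z x'"
  by (simp_all add: associator_def cd_mult_add)

lemma associator_scale:
  "associator n (c *\<^sub>R x) y z = c *\<^sub>R associator n x y z"
  "associator n y (c *\<^sub>R x) z = c *\<^sub>R associator n y x z"
  "associator n y z (c *\<^sub>R x) = c *\<^sub>R associator n y z x"
  by (simp_all add: associator_def cd_mult_scale scaleR_right_diff_distrib)

lemma associator_basis:
  assumes f: "frame \<phi> W" and W: "W \<subseteq> Pow {1..n}"
  shows "associator n (cd_basis (\<phi> p)) (cd_basis (\<phi> q)) (cd_basis (\<phi> r)) =
    assoc_coeff (table n \<phi>) p q r *\<^sub>R cd_basis (\<phi> (p \<oplus> q \<oplus> r))"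
proof -
  have sub: "\<phi> p \<subseteq> {1..n}" for p using frameD(4)[OF f] W by blast
  have m: "cd_mult n (cd_basis (\<phi> p)) (cd_basis (\<phi> q)) = table n \<phi> p q *\<^sub>R cd_basis (\<phi> (p \<oplus> q))" for p q
    by (simp add: cd_mult_basis[OF sub sub] table_def frameD(1)[OF f])
  show ?thesis
    by (simp add: associator_def m cd_mult_scale assoc_coeff_def scaleR_left_diff_distrib vadd_assoc)
qed

lemma alternative_associator:
  "alternative n A \<longleftrightarrow> (\<forall>x\<in>A. \<forall>y\<in>A. associator n x x y = 0 \<and> associator n y x x = 0)"
  by (simp add: alternative_def associator_def)

text \<open>Associators of basis elements are skew in neighbouring arguments; trilinearity carries
  this to the whole span, and two equal neighbours give an associator equal to its own
  negative.\<close>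

lemma alternative_if_octonionic:
  assumes f: "frame \<phi> W" and W: "W \<subseteq> Pow {1..n}" and o: "octonionic (table n \<phi>)"
  shows "alternative n (cd_supp W)"
proof -
  note c = assoc_coeff_of_octonionic[OF sign_table_table[OF f W] o]
  have perm: "q \<oplus> p \<oplus> r = p \<oplus> q \<oplus> r" "p \<oplus> r \<oplus> q = p \<oplus> q \<oplus> r" for p q r
    by (simp_all add: vadd_assoc vadd_comm vadd_left_comm)
  let ?b = "\<lambda>p. cd_basis (\<phi> p)"
  have L: "associator n (?b p) (?b q) (?b r) + associator n (?b q) (?b p) (?b r) = 0"
    and R: "associator n (?b p) (?b q) (?b r) + associator n (?b p) (?b r) (?b q) = 0" for p q r
    unfolding associator_basis[OF f W] perm[where p = p and q = q and r = r]
    by (simp_all only: c[where p = p and q = q and r = r] scaleR_minus_left right_minus)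
  \<comment> \<open>One subspace per argument and identity, so that basis elements can be replaced
    by general ones one argument at a time.\<close>
  have sub: "subspace {x. associator n x y z + associator n y x z = 0}"
    "subspace {y. associator n x y z + associator n y x z = 0}"
    "subspace {z. associator n x y z + associator n y x z = 0}"
    "subspace {x. associator n x y z + associator n x z y = 0}"
    "subspace {y. associator n x y z + associator n x z y = 0}"
    "subspace {z. associator n x y z + associator n x z y = 0}" for x y z
    by (intro linear_subspace_kernel linearI;
        simp add: associator_add associator_scale scaleR_right_distrib add_ac)+
  have LR: "associator n x y z + associator n y x z = 0" "associator n x y z + associator n x z y = 0"
    if "x \<in> cd_supp W" "y \<in> cd_supp W" "z \<in> cd_supp W" for x y z
  proof -
    note ind = cd_supp_induct[OF f that(3)] cd_supp_induct[OF f that(2)] cd_supp_induct[OF f that(1)]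
    have 1: "associator n (?b p) (?b q) z + associator n (?b q) (?b p) z = 0" for p q
      by (rule ind(1)[OF sub(3) L])
    have 2: "associator n (?b p) (?b q) z + associator n (?b p) z (?b q) = 0" for p q
      by (rule ind(1)[OF sub(6) R])
    have 3: "associator n (?b p) y z + associator n y (?b p) z = 0" for p
      by (rule ind(2)[OF sub(2) 1])
    have 4: "associator n (?b p) y z + associator n (?b p) z y = 0" for p
      by (rule ind(2)[OF sub(5) 2])
    show "associator n x y z + associator n y x z = 0"
      by (rule ind(3)[OF sub(1) 3])
    show "associator n x y z + associator n x z y = 0"
      by (rule ind(3)[OF sub(4) 4])
  qed
  have dbl: "x = 0" if "x + x = 0" for x :: "nat set \<Rightarrow> real"
    using that by (auto simp: fun_eq_iff)
  show ?thesis
    unfolding alternative_associator using LR dbl by blast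
qed

text \<open>Polarisation: expanding the alternative laws at a sum of two elements makes the
  associator skew, and evaluation on basis elements gives skew coefficients.\<close>

lemma octonionic_if_alternative:
  assumes f: "frame \<phi> W" and W: "W \<subseteq> Pow {1..n}" and A: "alternative n (cd_supp W)"
  shows "octonionic (table n \<phi>)"
proof (rule octonionic_of_assoc_coeff[OF sign_table_table[OF f W]])
  fix p q r
  let ?t = "table n \<phi>" and ?b = "\<lambda>p. cd_basis (\<phi> p)"
  have z: "associator n x x y = 0" "associator n y x x = 0" if "x \<in> cd_supp W" "y \<in> cd_supp W" for x y
    using that A by (auto simp: alternative_associator)
  have add: "x + y \<in> cd_supp W" if "x \<in> cd_supp W" "y \<in> cd_supp W" for x y
    using that subspace_cd_supp subspace_add by blast
  have skew: "associator n x y z = - associator n y x z" "associator n x y z = - associator n x z y"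
    if "x \<in> cd_supp W" "y \<in> cd_supp W" "z \<in> cd_supp W" for x y z
    using z(1)[OF add[OF that(1,2)] that(3)] z(2)[OF add[OF that(2,3)] that(1)] z that
    by (simp_all add: associator_add add_eq_0_iff2 add_eq_0_iff)
  have b: "?b p \<in> cd_supp W" for p by (simp add: frameD(4)[OF f])
  have perm: "q \<oplus> p \<oplus> r = p \<oplus> q \<oplus> r" "p \<oplus> r \<oplus> q = p \<oplus> q \<oplus> r"
    by (simp_all add: vadd_assoc vadd_comm vadd_left_comm)
  have nz: "cd_basis a \<noteq> 0" for a by (metis cd_basis_def zero_fun_apply zero_neq_one)
  note ab = associator_basis[OF f W]
  have "assoc_coeff ?t q p r *\<^sub>R ?b (p \<oplus> q \<oplus> r) = (- assoc_coeff ?t p q r) *\<^sub>R ?b (p \<oplus> q \<oplus> r)"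
    using skew(1)[OF b b b, of q p r] ab[of q p r] ab[of p q r] unfolding perm by simp
  then show "assoc_coeff ?t q p r = - assoc_coeff ?t p q r"
    unfolding scaleR_cancel_right using nz by blast
  have "assoc_coeff ?t p r q *\<^sub>R ?b (p \<oplus> q \<oplus> r) = (- assoc_coeff ?t p q r) *\<^sub>R ?b (p \<oplus> q \<oplus> r)"
    using skew(2)[OF b b b, of p r q] ab[of p r q] ab[of p q r] unfolding perm by simp
  then show "assoc_coeff ?t p r q = - assoc_coeff ?t p q r"
    unfolding scaleR_cancel_right using nz by blast
qed

lemma alternative_iff_octonionic:
  "frame \<phi> W \<Longrightarrow> W \<subseteq> Pow {1..n} \<Longrightarrow> alternative n (cd_supp W) \<longleftrightarrow> octonionic (table n \<phi>)"
  using alternative_if_octonionic octonionic_if_alternative by blast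

text \<open>The monomial map from the basis element at \<open>\<phi> v\<close> to
  \<open>\<eta> v\<close> times the one at \<open>\<phi>' v\<close>. It ignores coordinates outside
  the range of \<phi>, so it is linear on the whole type, as \<open>cd_isomorphic\<close>
  demands.\<close>

definition frame_map :: "(vec \<Rightarrow> real) \<Rightarrow> (vec \<Rightarrow> nat set) \<Rightarrow> (vec \<Rightarrow> nat set) \<Rightarrow> (nat set \<Rightarrow> real) \<Rightarrow> (nat set \<Rightarrow> real)"
  where "frame_map \<eta> \<phi> \<phi>' x = (\<Sum>v\<in>UNIV. (x (\<phi> v) * \<eta> v) *\<^sub>R cd_basis (\<phi>' v))"

lemma linear_frame_map: "linear (frame_map \<eta> \<phi> \<phi>')"
  by (rule linearI) (simp_all add: frame_map_def scaleR_fun_apply algebra_simps sum.distrib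
      scaleR_left_distrib scaleR_sum_right)

lemma frame_map_apply:
  assumes "frame \<phi>' W'"
  shows "frame_map \<eta> \<phi> \<phi>' x (\<phi>' w) = x (\<phi> w) * \<eta> w"
proof -
  have "frame_map \<eta> \<phi> \<phi>' x (\<phi>' w) = (\<Sum>v\<in>UNIV. if v = w then x (\<phi> v) * \<eta> v else 0)"
    unfolding frame_map_def sum_fun_apply
    by (rule sum.cong) (auto simp: scaleR_fun_apply cd_basis_def frameD(6)[OF assms])
  then show ?thesis by simp
qed

lemma frame_map_in_supp:
  assumes "frame \<phi>' W'" shows "frame_map \<eta> \<phi> \<phi>' x \<in> cd_supp W'"
  unfolding frame_map_def
  by (intro subspace_sum subspace_scale subspace_cd_supp) (simp add: frameD(4)[OF assms])

lemma frame_map_inverse: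
  assumes f: "frame \<phi> W" and f': "frame \<phi>' W'" and \<eta>: "\<And>v. \<eta> v * \<eta> v = 1" and x: "x \<in> cd_supp W"
  shows "frame_map \<eta> \<phi>' \<phi> (frame_map \<eta> \<phi> \<phi>' x) = x"
proof
  fix a
  show "frame_map \<eta> \<phi>' \<phi> (frame_map \<eta> \<phi> \<phi>' x) a = x a"
  proof (cases "a \<in> W")
    case True
    then obtain v where "a = \<phi> v" using frameD(3)[OF f] by blast
    then show ?thesis using \<eta> by (simp add: frame_map_apply[OF f] frame_map_apply[OF f'] mult.assoc)
  next
    case False
    then show ?thesis using x frame_map_in_supp[OF f, of \<eta> \<phi>'] unfolding cd_supp_def by force
  qed
qed

lemma frame_map_basis:
  assumes "frame \<phi> W"
  shows "frame_map \<eta> \<phi> \<phi>' (cd_basis (\<phi> w)) = \<eta> w *\<^sub>R cd_basis (\<phi>' w)"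
proof -
  have "frame_map \<eta> \<phi> \<phi>' (cd_basis (\<phi> w)) = (\<Sum>v\<in>UNIV. if v = w then \<eta> v *\<^sub>R cd_basis (\<phi>' v) else 0)"
    unfolding frame_map_def
    by (rule sum.cong) (auto simp: cd_basis_def frameD(6)[OF assms])
  then show ?thesis by simp
qed

text \<open>Rescaling basis elements by \<eta> changes the multiplication signs by the coboundary of
  \<eta>, so \<open>frame_map\<close> is multiplicative on basis elements, hence by bilinearity
  everywhere.\<close>

lemma cd_isomorphic_of_table:
  assumes f: "frame \<phi> W" and W: "W \<subseteq> Pow {1..n}" and f': "frame \<phi>' W'" and W': "W' \<subseteq> Pow {1..k}"
    and pm: "\<And>v. \<eta> v = 1 \<or> \<eta> v = -1"
    and t: "\<And>p q. table n \<phi> p q = \<eta> p * \<eta> q * \<eta> (p \<oplus> q) * table k \<phi>' p q"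
  shows "cd_isomorphic n (cd_supp W) k (cd_supp W')"
proof -
  let ?f = "frame_map \<eta> \<phi> \<phi>'"
  have sq: "\<eta> v * \<eta> v = 1" "\<eta> v * (\<eta> v * c) = c" for v c using pm[of v] by auto
  have sub: "\<phi> p \<subseteq> {1..n}" "\<phi>' p \<subseteq> {1..k}" for p
    using frameD(4)[OF f] frameD(4)[OF f'] W W' by blast+
  have m: "cd_mult n (cd_basis (\<phi> p)) (cd_basis (\<phi> q)) = table n \<phi> p q *\<^sub>R cd_basis (\<phi> (p \<oplus> q))"
    "cd_mult k (cd_basis (\<phi>' p)) (cd_basis (\<phi>' q)) = table k \<phi>' p q *\<^sub>R cd_basis (\<phi>' (p \<oplus> q))" for p q
    by (simp_all add: cd_mult_basis[OF sub(1) sub(1)] cd_mult_basis[OF sub(2) sub(2)] table_def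
      frameD(1)[OF f] frameD(1)[OF f'])
  note lin = linear_frame_map[of \<eta> \<phi> \<phi>']
  have bas: "?f (cd_mult n (cd_basis (\<phi> p)) (cd_basis (\<phi> q))) =
      cd_mult k (?f (cd_basis (\<phi> p))) (?f (cd_basis (\<phi> q)))" for p q
    by (simp add: m linear_scale[OF lin] frame_map_basis[OF f] cd_mult_scale t sq mult.commute mult.left_commute)
  have sub: "subspace {x. ?f (cd_mult n x y) = cd_mult k (?f x) (?f y)}"
    "subspace {y. ?f (cd_mult n x y) = cd_mult k (?f x) (?f y)}" for x y
    by (auto simp: subspace_def linear_0[OF lin] linear_add[OF lin] linear_scale[OF lin] cd_mult_add cd_mult_scale)
  have "?f (cd_mult n x y) = cd_mult k (?f x) (?f y)" if "x \<in> cd_supp W" "y \<in> cd_supp W" for x y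
  proof -
    have "?f (cd_mult n (cd_basis (\<phi> p)) y) = cd_mult k (?f (cd_basis (\<phi> p))) (?f y)" for p
      by (rule cd_supp_induct[OF f that(2)], rule sub, rule bas)
    then show ?thesis
      by - (rule cd_supp_induct[OF f that(1)], rule sub, assumption)
  qed
  moreover have "bij_betw ?f (cd_supp W) (cd_supp W')"
    by (rule bij_betw_byWitness[where f' = "frame_map \<eta> \<phi>' \<phi>"])
      (use frame_map_inverse[OF f f' sq(1)] frame_map_inverse[OF f' f sq(1)]
        frame_map_in_supp[OF f] frame_map_in_supp[OF f'] in auto)
  ultimately show ?thesis using lin unfolding cd_isomorphic_def by blast
qed

lemma octonionic_assoc:
  assumes "octonionic t"
  shows "assoc_sign t e1 e2 e3 = -1" "assoc_sign t e2 e1 e3 = -1" "assoc_sign t e1 e2 (e2 \<oplus> e3) = -1"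
  using assms unfolding octonionic_def by (simp_all add: dep3_def dep2_def)

text \<open>Both tables are octonionic, so their classifying signs are all -1 and the tables are
  equivalent.\<close>

lemma alternative_imp_isomorphic:
  assumes W: "W \<in> subgroups8 n" "alternative n (cd_supp W)" and W': "W' \<in> subgroups8 k" "alternative k (cd_supp W')"
  shows "cd_isomorphic n (cd_supp W) k (cd_supp W')"
proof -
  have sub: "W \<subseteq> Pow {1..n}" "W' \<subseteq> Pow {1..k}" using W W' by (auto simp: subgroups8_def)
  obtain \<phi> \<phi>' where f: "frame \<phi> W" "frame \<phi>' W'" using W(1) W'(1) subgroups8_obtain_frame by meson
  have o: "octonionic (table n \<phi>)" "octonionic (table k \<phi>')"
    using W W' alternative_iff_octonionic f sub by blast+
  obtain \<eta> where "\<And>p. \<eta> p = 1 \<or> \<eta> p = -1"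
      "\<And>p q. table n \<phi> p q = \<eta> p * \<eta> q * \<eta> (p \<oplus> q) * table k \<phi>' p q"
    using sign_table_equiv[OF sign_table_table[OF f(1) sub(1)] sign_table_table[OF f(2) sub(2)]]
      octonionic_assoc[OF o(1)] octonionic_assoc[OF o(2)] by metis
  then show ?thesis using cd_isomorphic_of_table[OF f(1) sub(1) f(2) sub(2)] by blast
qed

text \<open>Some \<open>kappa u\<close> repairs the table. As the table is not octonionic,
  \<open>u\<close> is nonzero, and a change of basis moves it to the standard form
  \<open>e3\<close>.\<close>

lemma non_alternative_frame:
  assumes W: "W \<in> subgroups8 n" "\<not> alternative n (cd_supp W)"
  obtains \<phi> where "frame \<phi> W" "octonionic (\<lambda>p q. kappa e3 p q * table n \<phi> p q)"
proof -
  have sub: "W \<subseteq> Pow {1..n}" using W by (auto simp: subgroups8_def)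
  obtain \<phi> where f: "frame \<phi> W" using W(1) subgroups8_obtain_frame by meson
  let ?t = "table n \<phi>"
  have o: "\<not> octonionic ?t" using W alternative_iff_octonionic f sub by blast
  obtain u where u: "octonionic (\<lambda>p q. kappa u p q * ?t p q)"
    using ex1_octonionic_kappa[OF sign_table_table[OF f sub]] by blast
  have "kappa zv p q = 1" for p q by (cases p; cases q) (simp add: kappa_def)
  then have "u \<noteq> zv" using u o by auto
  then obtain \<psi> where \<psi>: "\<And>p q. \<psi> (p \<oplus> q) = \<psi> p \<oplus> \<psi> q" "inj \<psi>" "\<And>v. dot u (\<psi> v) = dot e3 v"
    using linear_form_coordinates by metis
  have i: "\<psi> x = \<psi> y \<longleftrightarrow> x = y" for x y using \<psi>(2) by (auto dest: injD)
  have z: "\<psi> zv = zv" using \<psi>(1)[of zv zv] by simp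
  then have iz: "\<psi> x = zv \<longleftrightarrow> x = zv" for x using i[of x zv] by simp
  have "surj \<psi>" using \<psi>(2) finite_UNIV_inj_surj finite_vec by blast
  then have "range (\<phi> \<circ> \<psi>) = W" using frameD(3)[OF f] by (metis image_comp)
  then have f': "frame (\<phi> \<circ> \<psi>) W" using f \<psi>(1,2) unfolding frame_def
    by (auto intro: inj_compose)
  have "kappa u (\<psi> p) (\<psi> q) = kappa e3 p q" for p q
    by (simp add: kappa_def dep2_def i iz \<psi>(3))
  then have "octonionic (\<lambda>p q. kappa e3 p q * table n (\<phi> \<circ> \<psi>) p q)"
    using octonionic_comp_iff[OF \<psi>(1,2), of "\<lambda>p q. kappa u p q * ?t p q"] u
    by (simp add: table_def)
  with f' that show ?thesis by blast
qed

text \<open>In frames from \<open>non_alternative_frame\<close> the same factor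
  \<open>kappa e3\<close> makes both tables octonionic. The corrected tables are equivalent, and the
  common factor cancels.\<close>

lemma non_alternative_imp_isomorphic:
  assumes W: "W \<in> subgroups8 n" "\<not> alternative n (cd_supp W)"
    and W': "W' \<in> subgroups8 k" "\<not> alternative k (cd_supp W')"
  shows "cd_isomorphic n (cd_supp W) k (cd_supp W')"
proof -
  have sub: "W \<subseteq> Pow {1..n}" "W' \<subseteq> Pow {1..k}" using W W' by (auto simp: subgroups8_def)
  obtain \<phi> where f: "frame \<phi> W" "octonionic (\<lambda>p q. kappa e3 p q * table n \<phi> p q)"
    using non_alternative_frame[OF W] .
  obtain \<phi>' where f': "frame \<phi>' W'" "octonionic (\<lambda>p q. kappa e3 p q * table k \<phi>' p q)"
    using non_alternative_frame[OF W'] .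
  note s = sign_table_kappa[OF sign_table_table[OF f(1) sub(1)], of e3]
    sign_table_kappa[OF sign_table_table[OF f'(1) sub(2)], of e3]
  obtain \<eta> where \<eta>: "\<And>p. \<eta> p = 1 \<or> \<eta> p = -1"
      "\<And>p q. kappa e3 p q * table n \<phi> p q = \<eta> p * \<eta> q * \<eta> (p \<oplus> q) * (kappa e3 p q * table k \<phi>' p q)"
    using sign_table_equiv[OF s] octonionic_assoc[OF f(2)] octonionic_assoc[OF f'(2)] by metis
  have "kappa e3 p q \<noteq> 0" for p q by (simp add: kappa_def)
  then have "table n \<phi> p q = \<eta> p * \<eta> q * \<eta> (p \<oplus> q) * table k \<phi>' p q" for p q
    using \<eta>(2)[of p q] by (metis mult.left_commute mult_left_cancel)
  then show ?thesis using cd_isomorphic_of_table[OF f(1) sub(1) f'(1) sub(2)] \<eta>(1) by blast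
qed

section \<open>Lifting subspaces through a doubling\<close>

text \<open>Products of the generators yield, up to sign, every basis element indexed by a sum of
  \<open>a\<close>, \<open>b\<close> and \<open>c\<close>.\<close>

lemma hull_cd_subalgebra:
  assumes f: "frame (comb a b c) W" and W: "W \<subseteq> Pow {1..n}"
  shows "cd_subalgebra n hull {cd_basis a, cd_basis b, cd_basis c} = cd_supp W"
proof
  let ?S = "{cd_basis a, cd_basis b, cd_basis c}"
  have "comb a b c e1 \<in> W" "comb a b c e2 \<in> W" "comb a b c e3 \<in> W" by (rule frameD(4)[OF f])+
  then have abc: "a \<in> W" "b \<in> W" "c \<in> W" by simp_all
  show "cd_subalgebra n hull ?S \<subseteq> cd_supp W"
    by (rule hull_minimal) (use abc cd_subalgebra_supp[OF subgroups8_frame[OF f W]] in auto)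
  have "cd_supp W \<subseteq> B" if S: "?S \<subseteq> B" and B: "cd_subalgebra n B" for B
  proof -
    have sB: "subspace B" and one: "cd_basis {} \<in> B"
      and mB: "\<And>x y. x \<in> B \<Longrightarrow> y \<in> B \<Longrightarrow> cd_mult n x y \<in> B"
      using B by (auto simp: cd_subalgebra_def)
    have step: "cd_basis (x \<triangle> y) \<in> B" if "cd_basis x \<in> B" "cd_basis y \<in> B" "x \<subseteq> {1..n}" "y \<subseteq> {1..n}" for x y
    proof -
      \<comment> \<open>Scaling the product by its own sign once more removes that sign.\<close>
      have "cd_sign n x y *\<^sub>R (cd_sign n x y *\<^sub>R cd_basis (x \<triangle> y)) \<in> B"
        using subspace_scale[OF sB mB[OF that(1,2)]] unfolding cd_mult_basis[OF that(3,4)] .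
      moreover have "cd_sign n x y * cd_sign n x y = 1" using cd_sign_pm[of n x y] by auto
      ultimately show ?thesis by simp
    qed
    have abc': "a \<subseteq> {1..n}" "b \<subseteq> {1..n}" "c \<subseteq> {1..n}" using abc W by blast+
    have "cd_basis x \<in> B" if xW: "x \<in> W" for x
    proof -
      obtain v where "x = comb a b c v" using xW frameD(3)[OF f] by blast
      then obtain i j k where x: "x = comb a b c (Vec i j k)" by (cases v) blast
      let ?a = "if i then a else {}" and ?b = "if j then b else {}" and ?c = "if k then c else {}"
      have "cd_basis ?a \<in> B" "cd_basis ?b \<in> B" "cd_basis ?c \<in> B" "?a \<subseteq> {1..n}" "?b \<subseteq> {1..n}" "?c \<subseteq> {1..n}"
        using S one abc' by auto
      then show ?thesis unfolding x comb_simps by (meson step symdiff_subset)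
    qed
    then have "span (cd_basis ` W) \<subseteq> B" by (intro span_minimal sB) auto
    then show ?thesis using span_cd_basis[OF frameD(8)[OF f]] by simp
  qed
  then show "cd_supp W \<subseteq> cd_subalgebra n hull ?S"
    unfolding hull_def by blast
qed

section \<open>The three generating triples of quasi-octonion algebras\<close>

lemma symdiff_eq: "a \<triangle> b = (a - b) \<union> (b - a)"
  by (auto simp: symdiff_def)

lemma range_comb_subset:
  assumes "a \<subseteq> S" "b \<subseteq> S" "c \<subseteq> S" shows "range (comb a b c) \<subseteq> Pow S"
proof -
  have "comb a b c v \<subseteq> S" for v
    using assms by (cases v) (simp add: symdiff_subset)
  then show ?thesis by blast
qed

text \<open>The points \<open>x\<close> and \<open>y\<close> certify that the generators are
  independent. The sign condition is an associator that equals -1 in every octonionic table, here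
  evaluated to 1.\<close>

lemma non_alternative_hull:
  assumes mem: "x \<in> a" "x \<notin> b" "b \<noteq> {}" "y \<in> c" "y \<notin> a" "y \<notin> b"
    and sub: "a \<subseteq> {1..n}" "b \<subseteq> {1..n}" "c \<subseteq> {1..n}"
    and as: "cd_sign n a b * cd_sign n (a \<triangle> b) (b \<triangle> c) * cd_sign n b (b \<triangle> c) * cd_sign n a c = 1"
  obtains W where "W \<in> subgroups8 n" "cd_subalgebra n hull {cd_basis a, cd_basis b, cd_basis c} = cd_supp W"
    "\<not> alternative n (cd_supp W)"
proof -
  let ?W = "range (comb a b c)"
  have f: "frame (comb a b c) ?W"
  proof (rule frame_comb)
    have "y \<notin> a \<triangle> b" using mem by (simp add: symdiff_def)
    then show "c \<notin> {{}, a, b, a \<triangle> b}" using mem by blast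
  qed (use mem in blast)+
  have W: "?W \<subseteq> Pow {1..n}" using range_comb_subset[OF sub] .
  have "assoc_sign (table n (comb a b c)) e1 e2 (e2 \<oplus> e3) = 1"
    using as by (simp add: assoc_sign_def table_def)
  then have "\<not> octonionic (table n (comb a b c))" using octonionic_assoc(3) by fastforce
  then show ?thesis
    using that subgroups8_frame[OF f W] hull_cd_subalgebra[OF f W] alternative_iff_octonionic[OF f W] by blast
qed

lemma P4_supp: obtains W where "W \<in> subgroups8 4" "P4 = cd_supp W" "\<not> alternative 4 P4"
proof (rule non_alternative_hull[of 1 "{1}" "{2}" 3 "{3, 4}" 4])
  show "cd_sign 4 {1} {2} * cd_sign 4 ({1} \<triangle> {2}) ({2} \<triangle> {3, 4}) *
      cd_sign 4 {2} ({2} \<triangle> {3, 4}) * cd_sign 4 {1} {3, 4} = 1"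
    by (simp add: symdiff_eq insert_Diff_if numeral_eq_Suc conj_sign_def)
qed (use that in \<open>auto simp: P4_def symdiff_def\<close>)

lemma P12_supp: obtains W where "W \<in> subgroups8 5" "P12 = cd_supp W" "\<not> alternative 5 P12"
proof (rule non_alternative_hull[of 1 "{1}" "{2, 4}" 3 "{3, 4, 5}" 5])
  show "cd_sign 5 {1} {2, 4} * cd_sign 5 ({1} \<triangle> {2, 4}) ({2, 4} \<triangle> {3, 4, 5}) *
      cd_sign 5 {2, 4} ({2, 4} \<triangle> {3, 4, 5}) * cd_sign 5 {1} {3, 4, 5} = 1"
    by (simp add: symdiff_eq insert_Diff_if numeral_eq_Suc conj_sign_def)
qed (use that in \<open>auto simp: P12_def symdiff_def\<close>)

lemma P14_supp: obtains W where "W \<in> subgroups8 6" "P14 = cd_supp W" "\<not> alternative 6 P14"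
proof (rule non_alternative_hull[of 1 "{1, 4}" "{2, 5}" 3 "{3, 6}" 6])
  show "cd_sign 6 {1, 4} {2, 5} * cd_sign 6 ({1, 4} \<triangle> {2, 5}) ({2, 5} \<triangle> {3, 6}) *
      cd_sign 6 {2, 5} ({2, 5} \<triangle> {3, 6}) * cd_sign 6 {1, 4} {3, 6} = 1"
    by (simp add: symdiff_eq insert_Diff_if numeral_eq_Suc conj_sign_def)
qed (use that in \<open>auto simp: P14_def symdiff_def\<close>)

lemma symdiff_single: "x \<notin> a \<Longrightarrow> a \<triangle> {x} = insert x a"
  by (auto simp: symdiff_def)

section \<open>Linear forms and the lifts they define\<close>

lemma dot_coords:
  assumes "\<And>p q. h (p \<oplus> q) = (h p \<noteq> h q)"
  shows "h v = dot (Vec (h e1) (h e2) (h e3)) v"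
proof (cases v)
  case (Vec a b c)
  have z: "\<not> h zv" using assms[of zv zv] by simp
  have "v = (if a then e1 else zv) \<oplus> (if b then e2 else zv) \<oplus> (if c then e3 else zv)"
    using Vec by simp
  then have "h v = ((h (if a then e1 else zv) \<noteq> h (if b then e2 else zv)) \<noteq> h (if c then e3 else zv))"
    by (simp only: assms)
  then show ?thesis using z Vec by simp
qed

lemma dot_inj: "(\<And>v. dot u v = dot w v) \<Longrightarrow> u = w"
proof -
  assume "\<And>v. dot u v = dot w v"
  from this[of e1] this[of e2] this[of e3] show ?thesis by (cases u; cases w) simp
qed

text \<open>The graph of the linear form \<open>dot u\<close>: the new index is adjoined where the
  form takes the value 1.\<close>

definition lift :: "nat \<Rightarrow> (vec \<Rightarrow> nat set) \<Rightarrow> vec \<Rightarrow> vec \<Rightarrow> nat set"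
  where "lift n \<phi> u v = (if dot u v then insert (Suc n) (\<phi> v) else \<phi> v)"

context
  fixes n :: nat and \<phi> :: "vec \<Rightarrow> nat set" and W :: "nat set set"
  assumes f: "frame \<phi> W" and W: "W \<subseteq> Pow {1..n}"
begin

lemma Suc_notin_frame: "Suc n \<notin> \<phi> p"
  using frameD(4)[OF f] W by fastforce

lemma frame_subset: "\<phi> p \<subseteq> {1..n}"
  using frameD(4)[OF f] W by blast

lemma lift_drop: "lift n \<phi> u v - {Suc n} = \<phi> v" "Suc n \<in> lift n \<phi> u v \<longleftrightarrow> dot u v"
  using Suc_notin_frame[of v] by (simp_all add: lift_def)

lemma lift_frame: "frame (lift n \<phi> u) (range (lift n \<phi> u))"
proof -
  have "lift n \<phi> u (p \<oplus> q) = lift n \<phi> u p \<triangle> lift n \<phi> u q" for p q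
    using Suc_notin_frame[of p] Suc_notin_frame[of q]
    by (auto simp: lift_def dot_add frameD(1)[OF f] symdiff_insert)
  moreover have "inj (lift n \<phi> u)"
    using lift_drop(1)[of u] frameD(6)[OF f] by (metis injI)
  ultimately show ?thesis by (simp add: frame_def)
qed

lemma lift_subset: "range (lift n \<phi> u) \<subseteq> Pow {1..Suc n}"
proof -
  have "lift n \<phi> u v \<subseteq> {1..Suc n}" for v
    using frame_subset[of v] by (auto simp: lift_def)
  then show ?thesis by blast
qed

text \<open>For independent \<open>p\<close> and \<open>q\<close>, adjoining the new index to either
  or both reverses the sign: by a swap of factors, by conjugation, or by both together with the
  explicit minus sign. On dependent pairs all sign tables agree.\<close>

lemma table_lift: "table (Suc n) (lift n \<phi> u) p q = kappa u p q * table n \<phi> p q"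
proof -
  note S = cd_sign_Suc[OF Suc_notin_frame Suc_notin_frame, of p q]
  show ?thesis
  proof (cases "dep2 p q")
    case True
    then consider "p = zv" | "q = zv" | "p \<noteq> zv" "p = q" by (auto simp: dep2_def)
    then show ?thesis
    proof cases
      case 1
      then show ?thesis using frameD(5)[OF f] frameD(5)[OF lift_frame]
        by (simp add: table_def kappa_def dep2_def cd_sign_empty del: cd_sign.simps)
    next
      case 2
      then show ?thesis using frameD(5)[OF f] frameD(5)[OF lift_frame]
        by (simp add: table_def kappa_def dep2_def cd_sign_empty del: cd_sign.simps)
    next
      case 3
      then show ?thesis
        using sign_tableD(4)[OF sign_table_table[OF f W]] sign_tableD(4)[OF sign_table_table[OF lift_frame lift_subset]]
        by (simp add: kappa_def dep2_def)
    qed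
  next
    case False
    then have "\<phi> q \<noteq> {}" "cd_sign n (\<phi> q) (\<phi> p) = - cd_sign n (\<phi> p) (\<phi> q)"
      using sign_tableD(5)[OF sign_table_table[OF f W]] frameD(7)[OF f] by (auto simp: table_def dep2_def)
    then show ?thesis using False S
      by (simp add: table_def lift_def kappa_def conj_sign_def del: cd_sign.simps)
  qed
qed

lemma ex1_alternative_lift: "\<exists>!u. alternative (Suc n) (cd_supp (range (lift n \<phi> u)))"
proof -
  have "alternative (Suc n) (cd_supp (range (lift n \<phi> u))) \<longleftrightarrow>
      octonionic (\<lambda>p q. kappa u p q * table n \<phi> p q)" for u
    unfolding alternative_iff_octonionic[OF lift_frame lift_subset]
    using table_lift[of u] by presburger
  then show ?thesis using ex1_octonionic_kappa[OF sign_table_table[OF f W]] by simp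
qed

lemma inj_lift: "inj (\<lambda>u. range (lift n \<phi> u))"
proof (rule injI)
  fix u w assume eq: "range (lift n \<phi> u) = range (lift n \<phi> w)"
  have "lift n \<phi> u v = lift n \<phi> w v" for v
  proof -
    obtain v' where "lift n \<phi> u v = lift n \<phi> w v'" using eq by (metis imageE rangeI)
    then show ?thesis using lift_drop(1) frameD(6)[OF f] by metis
  qed
  then show "u = w" using lift_drop(2) by (intro dot_inj) metis
qed

text \<open>If \<open>V\<close> misses \<open>{Suc n}\<close>, the kernel of deleting
  \<open>Suc n\<close>, then \<open>V\<close> projects isomorphically onto \<open>W\<close> and is
  the graph of a linear form.\<close>

lemma lifts_eq:
  "{V \<in> subgroups8 (Suc n). {Suc n} \<notin> V \<and> (\<lambda>a. a - {Suc n}) ` V = W} = range (\<lambda>u. range (lift n \<phi> u))"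
    (is "?L = ?R")
proof
  show "?R \<subseteq> ?L"
  proof
    fix V assume "V \<in> ?R"
    then obtain u where V: "V = range (lift n \<phi> u)" by blast
    have "V \<in> subgroups8 (Suc n)" unfolding V by (rule subgroups8_frame[OF lift_frame lift_subset])
    moreover have "(\<lambda>a. a - {Suc n}) ` V = W"
      unfolding V image_image lift_drop by (rule frameD(3)[OF f])
    \<comment> \<open>Such a point would lie over the zero vector, where every linear form
      vanishes.\<close>
    moreover have "{Suc n} \<noteq> lift n \<phi> u v" for v
    proof
      assume *: "{Suc n} = lift n \<phi> u v"
      then have "\<phi> v = {}" using lift_drop(1)[of u v] by auto
      then have "v = zv" using frameD(7)[OF f] by blast
      moreover have "dot u v" using * lift_drop(2)[of u v] by auto
      ultimately show False by (cases u) simp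
    qed
    ultimately show "V \<in> ?L" using V by blast
  qed
  show "?L \<subseteq> ?R"
  proof
    fix V assume "V \<in> ?L"
    then have V: "V \<in> subgroups8 (Suc n)" "{Suc n} \<notin> V" and VW: "(\<lambda>a. a - {Suc n}) ` V = W" by auto
    have cl: "a \<triangle> b \<in> V" if "a \<in> V" "b \<in> V" for a b using that V by (auto simp: subgroups8_def)
    have dist: "(a - {Suc n}) \<triangle> (b - {Suc n}) = (a \<triangle> b) - {Suc n}" for a b by (auto simp: symdiff_def)
    have inj: "a = b" if "a \<in> V" "b \<in> V" "a - {Suc n} = b - {Suc n}" for a b
    proof -
      have "(a \<triangle> b) - {Suc n} = {}" using that(3) dist[of a b] by simp
      then have "a \<triangle> b = {} \<or> a \<triangle> b = {Suc n}" by blast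
      then show ?thesis using cl[OF that(1,2)] V(2) by (metis symdiff_eq_empty)
    qed
    have "\<exists>a\<in>V. a - {Suc n} = \<phi> v" for v
      using VW frameD(4)[OF f, of v] by blast
    \<comment> \<open>\<rho> inverts the projection. Recording whether \<open>Suc n\<close> occurs
      in \<open>\<rho> v\<close> gives the linear form, and its values at the unit vectors give
      \<open>u\<close>.\<close>
    then obtain \<rho> where \<rho>: "\<And>v. \<rho> v \<in> V" "\<And>v. \<rho> v - {Suc n} = \<phi> v" by metis
    have add: "\<rho> (p \<oplus> q) = \<rho> p \<triangle> \<rho> q" for p q
      by (rule inj) (use \<rho> cl dist[of "\<rho> p" "\<rho> q"] frameD(1)[OF f] in auto)
    define u where "u = Vec (Suc n \<in> \<rho> e1) (Suc n \<in> \<rho> e2) (Suc n \<in> \<rho> e3)"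
    have "(Suc n \<in> \<rho> v) = dot u v" for v
      unfolding u_def by (rule dot_coords) (auto simp: add symdiff_def)
    then have "\<rho> v = lift n \<phi> u v" for v
      using \<rho>(2)[of v] unfolding lift_def by auto
    moreover have "V = range \<rho>"
    proof
      show "range \<rho> \<subseteq> V" using \<rho> by blast
      show "V \<subseteq> range \<rho>"
      proof
        fix a assume "a \<in> V"
        then obtain v where "a - {Suc n} = \<phi> v" using VW frameD(3)[OF f] by blast
        then have "a = \<rho> v" using inj \<open>a \<in> V\<close> \<rho> by metis
        then show "a \<in> range \<rho>" by blast
      qed
    qed
    ultimately show "V \<in> ?R" by (metis (no_types, lifting) image_cong rangeI)
  qed
qed

text \<open>Of the eight lifts, one for each form, exactly one is alternative.\<close>

lemma card_non_alternative_lifts: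
  "card {V \<in> subgroups8 (Suc n). {Suc n} \<notin> V \<and> (\<lambda>a. a - {Suc n}) ` V = W \<and> \<not> alternative (Suc n) (cd_supp V)} = 7"
proof -
  obtain u where u: "\<And>w. alternative (Suc n) (cd_supp (range (lift n \<phi> w))) \<longleftrightarrow> w = u"
    using ex1_alternative_lift by metis
  have "{V \<in> subgroups8 (Suc n). {Suc n} \<notin> V \<and> (\<lambda>a. a - {Suc n}) ` V = W \<and> \<not> alternative (Suc n) (cd_supp V)} =
      {V \<in> range (\<lambda>u. range (lift n \<phi> u)). \<not> alternative (Suc n) (cd_supp V)}"
    unfolding lifts_eq[symmetric] by blast
  also have "\<dots> = (\<lambda>u. range (lift n \<phi> u)) ` (UNIV - {u})" using u by auto
  also have "card \<dots> = card (UNIV - {u})" by (rule card_image) (use inj_lift in \<open>auto intro: inj_on_subset\<close>)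
  also have "\<dots> = 7" using card_vec by simp
  finally show ?thesis .
qed

end

text \<open>\<open>V\<close> is spanned by \<open>{Suc n}\<close> and two vectors \<open>a\<close>,
  \<open>b\<close> from the old index space, so its algebra doubles the quaternion algebra of
  \<open>a\<close> and \<open>b\<close>. The quaternion signs alone determine the three classifying
  associators.\<close>

lemma alternative_if_mem:
  assumes V: "V \<in> subgroups8 (Suc n)" and E: "{Suc n} \<in> V"
  shows "alternative (Suc n) (cd_supp V)"
proof -
  have c: "card V = 8" using V by (simp add: subgroups8_def)
  have cl: "a \<triangle> b \<in> V" if "a \<in> V" "b \<in> V" for a b using that V by (auto simp: subgroups8_def)
  have sub: "V \<subseteq> Pow {1..Suc n}" using V by (simp add: subgroups8_def)
  have drop: "a - {Suc n} \<in> V" if "a \<in> V" for a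
  proof (cases "Suc n \<in> a")
    case True
    then have "a - {Suc n} = a \<triangle> {Suc n}" by (auto simp: symdiff_def)
    then show ?thesis using cl[OF that E] by simp
  qed (use that in auto)
  have "card {{}, {Suc n}} < 8" by (simp add: card_insert_if)
  then obtain a0 where a0: "a0 \<in> V" "a0 \<notin> {{}, {Suc n}}" by (rule ex_in_not_in_if_card_8[OF c, rotated]) auto
  define a where "a = a0 - {Suc n}"
  have a: "a \<in> V" "a \<noteq> {}" "Suc n \<notin> a" using a0 drop by (auto simp: a_def)
  \<comment> \<open>The excluded set is the span of \<open>{Suc n}\<close> and \<open>a\<close>;
    avoiding it keeps \<open>b\<close> nonzero and distinct from \<open>a\<close> after
    \<open>Suc n\<close> is deleted.\<close>
  have "card {{}, {Suc n}, a, insert (Suc n) a} < 8" by (simp add: card_insert_if)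
  then obtain b0 where b0: "b0 \<in> V" "b0 \<notin> {{}, {Suc n}, a, insert (Suc n) a}"
    by (rule ex_in_not_in_if_card_8[OF c, rotated]) auto
  define b where "b = b0 - {Suc n}"
  have b: "b \<in> V" "b \<noteq> {}" "Suc n \<notin> b" "a \<noteq> b" using b0 drop by (auto simp: b_def)
  have ab: "Suc n \<notin> a \<triangle> b" "a \<triangle> b \<noteq> {}" using a b by (auto simp: symdiff_def)
  have "{Suc n} \<notin> {{}, a, b, a \<triangle> b}" using a b ab by auto
  then have f: "frame (comb a b {Suc n}) V" using frame_comb_subgroups8[OF V a(1) b(1) E] a b by blast
  have "a \<subseteq> {1..Suc n}" "b \<subseteq> {1..Suc n}" using a b sub by auto
  then have an: "a \<subseteq> {1..n}" "b \<subseteq> {1..n}" using a(3) b(3) unfolding subset_Icc_Suc by simp_all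
  have S: "cd_sign (Suc n) x {Suc n} = 1" if "Suc n \<notin> x" for x
    using cd_sign_Suc(2)[OF that, of "{}"] cd_sign_empty by simp
  note cs = cd_sign_Suc[OF a(3) b(3)] cd_sign_Suc[OF b(3) a(3)] cd_sign_Suc[OF ab(1) b(3)] cd_sign_Suc[OF b(3) b(3)]
  have anti: "cd_sign n b a = - cd_sign n a b" "cd_sign n b (a \<triangle> b) = cd_sign n a b" "cd_sign n b b = -1"
    using cd_sign_anticommute[OF an] cd_sign_cyclic[OF an] cd_sign_self[OF an(2)] a b by auto
  have sq: "cd_sign n a b * cd_sign n a b = 1" using cd_sign_pm[of n a b] by auto
  have "octonionic (table (Suc n) (comb a b {Suc n}))"
    by (rule octonionicI[OF sign_table_table[OF f sub]];
      use sq in \<open>simp add: assoc_sign_def table_def symdiff_single[OF a(3)] symdiff_single[OF b(3)] symdiff_comm[of b a]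
        S a(3) b(3) ab(1) cs anti del: cd_sign.simps\<close>)
  then show ?thesis using alternative_iff_octonionic[OF f sub] by blast
qed

section \<open>Counting copies\<close>

lemma subgroups8_drop:
  assumes V: "V \<in> subgroups8 (Suc n)" and E: "{Suc n} \<notin> V"
  shows "(\<lambda>a. a - {Suc n}) ` V \<in> subgroups8 n"
proof -
  have cl: "a \<triangle> b \<in> V" if "a \<in> V" "b \<in> V" for a b using that V by (auto simp: subgroups8_def)
  have dist: "(a - {Suc n}) \<triangle> (b - {Suc n}) = (a \<triangle> b) - {Suc n}" for a b by (auto simp: symdiff_def)
  have "inj_on (\<lambda>a. a - {Suc n}) V"
  proof (rule inj_onI)
    fix a b assume ab: "a \<in> V" "b \<in> V" "a - {Suc n} = b - {Suc n}"
    then have "(a \<triangle> b) - {Suc n} = {}" using dist[of a b] by simp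
    then have "a \<triangle> b = {} \<or> a \<triangle> b = {Suc n}" by blast
    then show "a = b" using cl[OF ab(1,2)] E by (metis symdiff_eq_empty)
  qed
  then have "card ((\<lambda>a. a - {Suc n}) ` V) = 8" using V by (simp add: card_image subgroups8_def)
  moreover have "a - {Suc n} \<subseteq> {1..n}" if "a \<in> V" for a
  proof -
    have "a \<subseteq> {1..Suc n}" using V that unfolding subgroups8_def by blast
    then show ?thesis unfolding subset_Icc_Suc .
  qed
  moreover have "\<forall>a\<in>(\<lambda>a. a - {Suc n}) ` V. \<forall>b\<in>(\<lambda>a. a - {Suc n}) ` V. a \<triangle> b \<in> (\<lambda>a. a - {Suc n}) ` V"
    unfolding ball_simps dist using cl by blast
  ultimately show ?thesis unfolding subgroups8_def by blast
qed

text \<open>A non-alternative \<open>V\<close> misses \<open>{Suc n}\<close>, so it lies over a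
  unique subspace \<open>W\<close> of the old index space. Every fibre has seven such members,
  whatever the type of \<open>W\<close>.\<close>

lemma card_non_alternative_Suc:
  "card {V \<in> subgroups8 (Suc n). \<not> alternative (Suc n) (cd_supp V)} = 7 * card (subgroups8 n)"
proof -
  let ?N = "\<lambda>W. {V \<in> subgroups8 (Suc n). {Suc n} \<notin> V \<and> (\<lambda>a. a - {Suc n}) ` V = W \<and> \<not> alternative (Suc n) (cd_supp V)}"
  have "{V \<in> subgroups8 (Suc n). \<not> alternative (Suc n) (cd_supp V)} = (\<Union>W\<in>subgroups8 n. ?N W)"
    using alternative_if_mem subgroups8_drop by blast
  also have "card \<dots> = (\<Sum>W\<in>subgroups8 n. card (?N W))"
    by (rule card_UN_disjoint) (use finite_subgroups8 in auto)
  also have "\<dots> = (\<Sum>W\<in>subgroups8 n. 7)"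
  proof (rule sum.cong)
    fix W assume W: "W \<in> subgroups8 n"
    then obtain \<phi> where "frame \<phi> W" using subgroups8_obtain_frame by blast
    then show "card (?N W) = 7" using card_non_alternative_lifts W by (simp add: subgroups8_def)
  qed simp
  finally show ?thesis by simp
qed

text \<open>The full index space for \<open>n = 3\<close> contains \<open>{3}\<close>, hence is
  alternative as a double; alternativity then characterises its copies.\<close>

lemma num_octonion_copies_eq:
  "num_octonion_copies m = card {W \<in> subgroups8 (m + 3). alternative (m + 3) (cd_supp W)}"
proof -
  have "card (Pow {1..3::nat}) = 8" by (simp add: card_Pow)
  then have P: "Pow {1..3} \<in> subgroups8 3" by (auto simp: subgroups8_def symdiff_def)
  then have alt: "alternative 3 (cd_supp (Pow {1..3}))"
    using alternative_if_mem[of _ 2] by (simp add: numeral_3_eq_3)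
  have "cd_isomorphic n (cd_supp W) 3 (cd_space 3) \<or> cd_anti_isomorphic n (cd_supp W) 3 (cd_space 3)
      \<longleftrightarrow> alternative n (cd_supp W)" if "W \<in> subgroups8 n" for W n
    using that alternative_isomorphic[OF cd_subalgebra_supp] alternative_imp_isomorphic[OF _ _ P alt] alt
    unfolding cd_space_eq by blast
  then have "cd_copies (m + 3) 3 (cd_space 3) = cd_supp ` {W \<in> subgroups8 (m + 3). alternative (m + 3) (cd_supp W)}"
    unfolding cd_copies_eq by (intro arg_cong[where f = "image cd_supp"]) blast
  then show ?thesis
    by (simp add: num_octonion_copies_def card_image inj_on_subset[OF inj_cd_supp])
qed

text \<open>Isomorphisms and anti-isomorphisms preserve failure of alternativity, and any two
  non-alternative candidates are isomorphic; so the copies do not depend on the choice of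
  \<open>B\<close>.\<close>

lemma cd_copies_non_alternative:
  assumes V: "V \<in> subgroups8 k" "B = cd_supp V" "\<not> alternative k B"
  shows "cd_copies n k B = cd_supp ` {W \<in> subgroups8 n. \<not> alternative n (cd_supp W)}"
proof -
  have "cd_isomorphic n (cd_supp W) k B \<or> cd_anti_isomorphic n (cd_supp W) k B
      \<longleftrightarrow> \<not> alternative n (cd_supp W)" if "W \<in> subgroups8 n" for W
    using that alternative_isomorphic[OF cd_subalgebra_supp[OF that]] non_alternative_imp_isomorphic[OF that _ V(1)] V
    by blast
  then show ?thesis
    unfolding cd_copies_eq by (intro arg_cong[where f = "image cd_supp"]) blast
qed

text \<open>The three families coincide, so their union is a single family.\<close>

lemma num_quasi_octonion_copies_eq:
  "num_quasi_octonion_copies m = card {W \<in> subgroups8 (m + 3). \<not> alternative (m + 3) (cd_supp W)}"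
proof -
  let ?N = "cd_supp ` {W \<in> subgroups8 (m + 3). \<not> alternative (m + 3) (cd_supp W)}"
  have "cd_copies (m + 3) 4 P4 = ?N" by (rule P4_supp) (rule cd_copies_non_alternative)
  moreover have "cd_copies (m + 3) 5 P12 = ?N" by (rule P12_supp) (rule cd_copies_non_alternative)
  moreover have "cd_copies (m + 3) 6 P14 = ?N" by (rule P14_supp) (rule cd_copies_non_alternative)
  ultimately have "cd_copies (m + 3) 4 P4 \<union> cd_copies (m + 3) 5 P12 \<union> cd_copies (m + 3) 6 P14 =
      cd_supp ` {W \<in> subgroups8 (m + 3). \<not> alternative (m + 3) (cd_supp W)}"
    by simp
  then show ?thesis
    by (simp add: num_quasi_octonion_copies_def card_image inj_on_subset[OF inj_cd_supp])
qed

theorem theorem8: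
  fixes m :: nat
  shows "num_quasi_octonion_copies (m + 1) =
    7 * (num_octonion_copies m + num_quasi_octonion_copies m)"
proof -
  let ?n = "m + 3"
  let ?A = "{W \<in> subgroups8 ?n. alternative ?n (cd_supp W)}" and ?N = "{W \<in> subgroups8 ?n. \<not> alternative ?n (cd_supp W)}"
  have "num_quasi_octonion_copies (m + 1) = 7 * card (subgroups8 ?n)"
  proof -
    have "m + 1 + 3 = Suc ?n" by simp
    then show ?thesis
      using card_non_alternative_Suc[of ?n] by (simp only: num_quasi_octonion_copies_eq)
  qed
  \<comment> \<open>Every three-dimensional subspace has one of the two types, so the octonion and
    quasi-octonion copies together account for all of them.\<close>
  also have "subgroups8 ?n = ?A \<union> ?N" by blast
  also have "card \<dots> = card ?A + card ?N"
    by (rule card_Un_disjoint) (auto simp: finite_subgroups8)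
  finally show ?thesis by (simp only: num_octonion_copies_eq num_quasi_octonion_copies_eq)
qed

end
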